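(* Let $d\in\{2,3\}$, $r>\frac{d+1}{2}$, $\beta_0>0$, $g>0$, and let $(\mathbf u_0,\eta_0)$ with $\mathbf u_0\in H$, $\eta_0$ a real mean-zero scalar function, satisfy $\|(\mathbf u_0,\eta_0)\|_{\beta_0}^2:=\|\mathbf u_0\|_{\beta_0}^2+\|\eta_0\|_{\beta_0}^2<\infty$. Then there is a constant $C>0$ depending only on $d$ such that the complexified inviscid Boussinesq system $$\frac{d\mathbf u}{d\zeta}+B(\mathbf u,\mathbf u)=g\,\mathbb P(\eta\,\mathbf e),\qquad \frac{d\eta}{d\zeta}+\mathbf u\cdot\nabla\eta=0,\qquad \mathbf u(0)=\mathbf u_0,\ \eta(0)=\eta_0,$$ admits a unique solution $(\mathbf u(\zeta),\eta(\zeta))$, holomorphic in $\zeta$, in the region $$\mathcal R=\Big\{\zeta=se^{i\theta}:\ \theta\in[0,2\pi),\ 0<s<\min\Big\{\frac{C\beta_0}{2^rC_W(r)\|(\mathbf u_0,\eta_0)\|_{\beta_0}},\ \frac{2\ln2}{g}\Big\}\Big\}.$$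
   Context: Periodic domain $\Omega=[0,2\pi]^d$; $H$ = real mean-zero divergence-free $L^2$ vector fields, complexified as $H+iH$; scalars are mean-zero and likewise complexified. $\mathbf e$ is the upward unit vector in $\mathbb R^d$, $g$ the gravitational constant. $A=-\Delta$ (Fourier multiplier $|\mathbf k|^2$), $\Lambda=A^{1/2}$. Gevrey norms $\|\mathbf u\|_\beta=\|A^{r/2}e^{\beta A^{1/2}}\mathbf u\|$ and $\|\eta\|_\beta=\|\Lambda^re^{\beta\Lambda}\eta\|$ ($L^2$ norms). $B(\mathbf u,\mathbf v)=\mathbb P(\mathbf u\cdot\nabla\mathbf v)$, $\mathbb P$ the Leray–Helmholtz projection; all nonlinear terms are extended complex-bilinearly. $C_W(r)=\frac{1}{\pi2^{d-1}}\frac{2r-d}{2r-1-d}$. *)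

theory Defs
  imports "HOL-Analysis.Analysis"
begin

text \<open>Fourier-side model on the torus [0,2pi]^d.  The dimension d is CARD('d).
  A (complexified) vector field is given by its Fourier coefficients
  F k n  (wavevector k in Z^d, component n), i.e. F(x) = sum_k F k e^{i k.x};
  a scalar field by its coefficients f k.\<close>

type_synonym 'd vf = "int^'d \<Rightarrow> 'd \<Rightarrow> complex"
type_synonym 'd sf = "int^'d \<Rightarrow> complex"

definition ksq :: "int^'d::finite \<Rightarrow> real" where
  "ksq k = (\<Sum>i\<in>UNIV. (real_of_int (k$i))^2)"

definition kabs :: "int^'d::finite \<Rightarrow> real" where
  "kabs k = sqrt (ksq k)"

text \<open>Fourier multiplier of A^{r/2} e^{beta A^{1/2}}, squared.\<close>
definition gweight :: "real \<Rightarrow> real \<Rightarrow> int^'d::finite \<Rightarrow> real" where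
  "gweight r \<beta> k = (kabs k) powr (2*r) * exp (2*\<beta>*kabs k)"

definition vf_gev :: "real \<Rightarrow> real \<Rightarrow> 'd::finite vf \<Rightarrow> bool" where
  "vf_gev r \<beta> F \<longleftrightarrow> (\<lambda>k. gweight r \<beta> k * (\<Sum>n\<in>UNIV. (cmod (F k n))^2)) summable_on UNIV"

definition sf_gev :: "real \<Rightarrow> real \<Rightarrow> 'd::finite sf \<Rightarrow> bool" where
  "sf_gev r \<beta> f \<longleftrightarrow> (\<lambda>k. gweight r \<beta> k * (cmod (f k))^2) summable_on UNIV"

text \<open>Squared Gevrey norms (L^2 normalisation: Parseval factor (2pi)^d).\<close>
definition vf_gnorm2 :: "real \<Rightarrow> real \<Rightarrow> 'd::finite vf \<Rightarrow> real" where
  "vf_gnorm2 r \<beta> F = (2*pi)^CARD('d) * (\<Sum>\<^sub>\<infinity>k. gweight r \<beta> k * (\<Sum>n\<in>UNIV. (cmod (F k n))^2))"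

definition sf_gnorm2 :: "real \<Rightarrow> real \<Rightarrow> 'd::finite sf \<Rightarrow> real" where
  "sf_gnorm2 r \<beta> f = (2*pi)^CARD('d) * (\<Sum>\<^sub>\<infinity>k. gweight r \<beta> k * (cmod (f k))^2)"

definition in_Hc :: "'d::finite vf \<Rightarrow> bool" where
  "in_Hc F \<longleftrightarrow> (\<forall>n. F 0 n = 0) \<and> (\<forall>k. (\<Sum>m\<in>UNIV. of_int (k$m) * F k m) = 0)"

definition real_vf :: "'d::finite vf \<Rightarrow> bool" where
  "real_vf F \<longleftrightarrow> (\<forall>k n. F (-k) n = cnj (F k n))"

definition real_sf :: "'d::finite sf \<Rightarrow> bool" where
  "real_sf f \<longleftrightarrow> (\<forall>k. f (-k) = cnj (f k))"

definition leray :: "'d::finite vf \<Rightarrow> 'd vf" where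
  "leray F k n = (if k = 0 then 0 else
     F k n - (\<Sum>m\<in>UNIV. of_int (k$m) * F k m) / complex_of_real (ksq k) * of_int (k$n))"

text \<open>Fourier coefficients of (u.grad) v and u.grad f (complex-bilinear).\<close>
definition adv_v :: "'d::finite vf \<Rightarrow> 'd vf \<Rightarrow> 'd vf" where
  "adv_v u v k n = (\<Sum>\<^sub>\<infinity>j. \<i> * (\<Sum>m\<in>UNIV. u j m * of_int ((k-j)$m)) * v (k-j) n)"

definition adv_s :: "'d::finite vf \<Rightarrow> 'd sf \<Rightarrow> 'd sf" where
  "adv_s u f k = (\<Sum>\<^sub>\<infinity>j. \<i> * (\<Sum>m\<in>UNIV. u j m * of_int ((k-j)$m)) * f (k-j))"

definition Bop :: "'d::finite vf \<Rightarrow> 'd vf \<Rightarrow> 'd vf" where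
  "Bop u v = leray (adv_v u v)"

definition times_e :: "'d::finite \<Rightarrow> 'd sf \<Rightarrow> 'd vf" where
  "times_e e f k n = (if n = e then f k else 0)"

text \<open>Holomorphy as a map into D(A^{r/2}) (resp. D(Lambda^r)): complex
  differentiability in the norm of that space.\<close>
definition hol_vf :: "real \<Rightarrow> complex set \<Rightarrow> (complex \<Rightarrow> 'd::finite vf) \<Rightarrow> bool" where
  "hol_vf r S U \<longleftrightarrow> (\<forall>\<zeta>\<in>S. vf_gev r 0 (U \<zeta>) \<and>
     (\<exists>W. vf_gev r 0 W \<and>
        ((\<lambda>h. vf_gnorm2 r 0 (\<lambda>k n. (U (\<zeta>+h) k n - U \<zeta> k n) / h - W k n)) \<longlongrightarrow> 0) (at 0)))"

definition hol_sf :: "real \<Rightarrow> complex set \<Rightarrow> (complex \<Rightarrow> 'd::finite sf) \<Rightarrow> bool" where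
  "hol_sf r S E \<longleftrightarrow> (\<forall>\<zeta>\<in>S. sf_gev r 0 (E \<zeta>) \<and>
     (\<exists>w. sf_gev r 0 w \<and>
        ((\<lambda>h. sf_gnorm2 r 0 (\<lambda>k. (E (\<zeta>+h) k - E \<zeta> k) / h - w k)) \<longlongrightarrow> 0) (at 0)))"

definition bouss_sol :: "real \<Rightarrow> real \<Rightarrow> 'd::finite \<Rightarrow> complex set \<Rightarrow> 'd vf \<Rightarrow> 'd sf
     \<Rightarrow> (complex \<Rightarrow> 'd vf) \<Rightarrow> (complex \<Rightarrow> 'd sf) \<Rightarrow> bool" where
  "bouss_sol r g e S u0 \<eta>0 U E \<longleftrightarrow>
     0 \<in> S \<and> U 0 = u0 \<and> E 0 = \<eta>0 \<and> hol_vf r S U \<and> hol_sf r S E \<and>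
     (\<forall>\<zeta>\<in>S. in_Hc (U \<zeta>) \<and> E \<zeta> 0 = 0) \<and>
     (\<forall>\<zeta>\<in>S. \<forall>k n. ((\<lambda>z. U z k n) has_field_derivative
          (- Bop (U \<zeta>) (U \<zeta>) k n + complex_of_real g * leray (times_e e (E \<zeta>)) k n)) (at \<zeta>)) \<and>
     (\<forall>\<zeta>\<in>S. \<forall>k. ((\<lambda>z. E z k) has_field_derivative (- adv_s (U \<zeta>) (E \<zeta>) k)) (at \<zeta>))"

definition C_W :: "nat \<Rightarrow> real \<Rightarrow> real" where
  "C_W d r = 1 / (pi * 2^(d-1)) * ((2*r - d) / (2*r - 1 - d))"

text \<open>Radius of R; if the data norm is 0 the first term of the min is +infinity.\<close>
definition radius :: "nat \<Rightarrow> real \<Rightarrow> real \<Rightarrow> real \<Rightarrow> real \<Rightarrow> real \<Rightarrow> real" where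
  "radius d C r \<beta>0 g N = (if N = 0 then 2 * ln 2 / g
      else min (C * \<beta>0 / (2 powr r * C_W d r * N)) (2 * ln 2 / g))"

end

(*
  Uniqueness. The complexified system has no energy identity, but a holomorphic solution is determined
  by its Taylor coefficients at 0. If two solutions agree to order n at 0 in every Fourier mode, then the
  partial sums of the difference of the two nonlinearities are holomorphic, vanish to order n, and are
  bounded uniformly by the local bound in D(Lambda^r); hence the whole difference is O(z^n), and
  integrating the equation once gives agreement to order n + 1.

  Existence. The formal power series solution is estimated by a Cauchy-Kovalevskaya argument in the scale
  of Wiener norms sum_k exp(b beta |k|) |u k|, 0 <= b < 1. Since |k| <= exp(s |k|) / s, each derivative
  costs 1 / (beta (c - b)) when passing from c to b, and the n-th coefficient is bounded in the b-norm by
  P M_n / (R (1 - b))^n for a numerical sequence M_n with sum M_n <= 2. The Gevrey norm controls the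
  initial Wiener norm because sum |k|^(-d-1) over the nonzero lattice points is finite. The buoyancy term
  is linear and feeds only u, so weighting eta by a large constant mu makes it as small as needed on
  g |zeta| < 2.
*)
theory Submission
  imports Defs "HOL-Complex_Analysis.Complex_Analysis"
begin

section \<open>Nonnegative sums and holomorphic functions\<close>

text \<open>The Wiener norms fit because they are weighted l^1 norms: exp (s |k|) is
  submultiplicative along k = j + (k - j), so a convolution is bounded by the product of the norms
  with constant 1, and the recursion produces no constant that depends on r. Two estimates tie r to
  the radius. In bounding the initial Wiener norm, r > (d + 1) / 2 admits the r-independent weight
  |k|^(-d-1) in Cauchy-Schwarz; and 2^r C_W(r) is at least 1 / (pi 2^(d-1)). Hence C depends on d
  alone. Holomorphy with values in D(Lambda^r) comes from the same estimate: strictly inside the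
  disc a positive exponential weight is left over, and it absorbs every power of |k|. A large \<mu>
  does no harm to the nonlinear terms because both are transport terms: \<open>u\<close> advects
  \<open>u\<close> and \<eta>, so \<mu> always sits on the transported factor and never has to be
  paid back. In the uniqueness part the obstacle is that agreement to order n holds mode by mode
  with constants that may vary with the mode, so the infinitely many terms of the nonlinearity
  cannot be estimated one at a time.\<close>

lemma nonneg_summable_boundI:
  fixes f :: "'a \<Rightarrow> real"
  assumes "\<And>x. 0 \<le> f x" and "\<And>F. finite F \<Longrightarrow> sum f F \<le> B"
  shows "f summable_on UNIV" and "infsum f UNIV \<le> B"
proof -
  show *: "f summable_on UNIV"
    by (rule nonneg_bdd_above_summable_on) (auto intro!: bdd_aboveI2 assms)
  show "infsum f UNIV \<le> B"
    using * assms(2) by (auto intro: infsum_le_finite_sums)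
qed

lemma nonneg_summable_mono:
  fixes f g :: "'a \<Rightarrow> real"
  assumes "g summable_on UNIV" "\<And>x. 0 \<le> f x" "\<And>x. f x \<le> g x"
  shows "f summable_on UNIV" and "infsum f UNIV \<le> infsum g UNIV"
proof -
  show "f summable_on UNIV"
    by (rule summable_on_comparison_test[OF assms(1)]) (use assms in auto)
  then show "infsum f UNIV \<le> infsum g UNIV"
    by (intro infsum_mono assms)
qed

lemma has_sum_sum:
  fixes f :: "'i \<Rightarrow> 'a \<Rightarrow> 'b::topological_comm_monoid_add"
  assumes "\<And>i. i \<in> I \<Longrightarrow> (f i has_sum s i) A"
  shows "((\<lambda>x. \<Sum>i\<in>I. f i x) has_sum (\<Sum>i\<in>I. s i)) A"
  using assms by (induction I rule: infinite_finite_induct) (auto intro!: has_sum_add)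

lemma infsum_Cauchy_Schwarz:
  fixes f g :: "'a \<Rightarrow> real"
  assumes f: "(\<lambda>x. (f x)\<^sup>2) summable_on UNIV" and g: "(\<lambda>x. (g x)\<^sup>2) summable_on UNIV"
    and nn: "\<And>x. 0 \<le> f x" "\<And>x. 0 \<le> g x"
  shows "(\<lambda>x. f x * g x) summable_on UNIV"
    and "(\<Sum>\<^sub>\<infinity>x. f x * g x) \<le> sqrt (\<Sum>\<^sub>\<infinity>x. (f x)\<^sup>2) * sqrt (\<Sum>\<^sub>\<infinity>x. (g x)\<^sup>2)"
proof -
  have fin: "(\<Sum>x\<in>F. f x * g x) \<le> sqrt (\<Sum>\<^sub>\<infinity>x. (f x)\<^sup>2) * sqrt (\<Sum>\<^sub>\<infinity>x. (g x)\<^sup>2)"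
    if "finite F" for F
  proof -
    have "(\<Sum>x\<in>F. f x * g x)\<^sup>2 \<le> (\<Sum>x\<in>F. (f x)\<^sup>2) * (\<Sum>x\<in>F. (g x)\<^sup>2)"
      by (rule Cauchy_Schwarz_ineq_sum)
    also have "\<dots> \<le> (\<Sum>\<^sub>\<infinity>x. (f x)\<^sup>2) * (\<Sum>\<^sub>\<infinity>x. (g x)\<^sup>2)"
      by (intro mult_mono finite_sum_le_infsum f g that infsum_nonneg sum_nonneg) auto
    finally show ?thesis
      by (metis real_le_rsqrt real_sqrt_mult)
  qed
  show "(\<lambda>x. f x * g x) summable_on UNIV"
    "(\<Sum>\<^sub>\<infinity>x. f x * g x) \<le> sqrt (\<Sum>\<^sub>\<infinity>x. (f x)\<^sup>2) * sqrt (\<Sum>\<^sub>\<infinity>x. (g x)\<^sup>2)"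
    using nonneg_summable_boundI[of "\<lambda>x. f x * g x", OF _ fin] nn by auto
qed

text \<open>The shear (k, j) -> (j, k - j) is a bijection of the index pairs and turns the double
  sum into a product. This is the algebra property behind the Wiener norms, with constant 1.\<close>

lemma convolution_summable:
  fixes p q :: "'a::ab_group_add \<Rightarrow> real"
  assumes p: "p summable_on UNIV" "\<And>x. 0 \<le> p x" and q: "q summable_on UNIV" "\<And>x. 0 \<le> q x"
  shows "(\<lambda>j. p j * q (k - j)) summable_on UNIV"
    and "(\<lambda>k. \<Sum>\<^sub>\<infinity>j. p j * q (k - j)) summable_on UNIV"
    and "(\<Sum>\<^sub>\<infinity>k. \<Sum>\<^sub>\<infinity>j. p j * q (k - j)) = infsum p UNIV * infsum q UNIV"
proof -
  have *: "(\<lambda>(j, l). p j * q l) summable_on UNIV \<times> UNIV"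
  proof (rule summable_on_SigmaI)
    show "((\<lambda>l. case (j, l) of (j, l) \<Rightarrow> p j * q l) has_sum p j * infsum q UNIV) UNIV" for j
      using has_sum_cmult_right[OF has_sum_infsum[OF q(1)]] by simp
    show "(\<lambda>j. p j * infsum q UNIV) summable_on UNIV"
      by (rule summable_on_cmult_left[OF p(1)])
  qed (use p q in auto)
  have bij: "bij_betw (\<lambda>(k, j). (j, k - j)) (UNIV \<times> UNIV) (UNIV \<times> (UNIV :: 'a set))"
    by (rule bij_betwI[where g = "\<lambda>(j, l). (j + l, j)"]) auto
  have 2: "(\<lambda>(k, j). p j * q (k - j)) summable_on UNIV \<times> UNIV"
    using summable_on_reindex_bij_betw[OF bij, of "\<lambda>(j, l). p j * q l"] *
    by (simp add: case_prod_unfold)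
  show "(\<lambda>j. p j * q (k - j)) summable_on UNIV"
    using summable_on_SigmaD1[OF 2, of k] p q by auto
  show "(\<lambda>k. \<Sum>\<^sub>\<infinity>j. p j * q (k - j)) summable_on UNIV"
    using summable_on_Sigma_banach[OF 2] by simp
  have "(\<Sum>\<^sub>\<infinity>k. \<Sum>\<^sub>\<infinity>j. p j * q (k - j)) = (\<Sum>\<^sub>\<infinity>(k, j)\<in>UNIV \<times> UNIV. p j * q (k - j))"
    using infsum_Sigma'_banach[OF 2] by simp
  also have "\<dots> = (\<Sum>\<^sub>\<infinity>(j, l)\<in>UNIV \<times> UNIV. p j * q l)"
    using infsum_reindex_bij_betw[OF bij, of "\<lambda>(j, l). p j * q l"]
    by (simp add: case_prod_unfold)
  also have "\<dots> = (\<Sum>\<^sub>\<infinity>j. \<Sum>\<^sub>\<infinity>l. p j * q l)"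
    using infsum_Sigma'_banach[OF *] by simp
  also have "\<dots> = infsum p UNIV * infsum q UNIV"
    by (simp add: infsum_cmult_right' infsum_cmult_left')
  finally show "(\<Sum>\<^sub>\<infinity>k. \<Sum>\<^sub>\<infinity>j. p j * q (k - j)) = infsum p UNIV * infsum q UNIV" .
qed

section \<open>Quantitative Taylor expansion and order of vanishing at a point\<close>

text \<open>Cauchy's inequality on the circle of radius \<rho> / 2 bounds the terms by a geometric
  sequence with ratio at most 1/2, whose tail costs a factor 2. The constant is explicit because it
  has to be the same for all Fourier modes and for all finite partial sums.\<close>

lemma taylor_remainder_bound:
  fixes f :: "complex \<Rightarrow> complex"
  assumes hol: "f holomorphic_on ball w \<rho>" and \<rho>: "\<rho> > 0"
    and M: "\<And>z. z \<in> ball w \<rho> \<Longrightarrow> cmod (f z) \<le> M" and z: "cmod (z - w) \<le> \<rho> / 4"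
  shows "cmod (f z - (\<Sum>i<n. (deriv ^^ i) f w / fact i * (z - w) ^ i)) \<le> 2 * M * (2 * cmod (z - w) / \<rho>) ^ n"
proof -
  define a where "a i = (deriv ^^ i) f w / fact i" for i
  define x where "x = 2 * cmod (z - w) / \<rho>"
  have x: "0 \<le> x" "x \<le> 1 / 2" using z \<rho> by (auto simp: x_def field_simps)
  have M0: "M \<ge> 0" using order_trans[OF norm_ge_zero M[of w]] \<rho> by simp
  have zb: "z \<in> ball w \<rho>" using z \<rho> by (auto simp: dist_norm norm_minus_commute)
  have sums: "(\<lambda>i. a i * (z - w) ^ i) sums f z"
    using holomorphic_power_series[OF hol zb] by (simp add: a_def)
  have a: "cmod (a i) \<le> M / (\<rho> / 2) ^ i" for i
  proof -
    have "cmod ((deriv ^^ i) f w) \<le> fact i * M / (\<rho> / 2) ^ i"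
    proof (rule Cauchy_inequality)
      show "f holomorphic_on ball w (\<rho> / 2)"
        by (rule holomorphic_on_subset[OF hol]) (use \<rho> in auto)
      show "continuous_on (cball w (\<rho> / 2)) f"
        by (rule holomorphic_on_imp_continuous_on, rule holomorphic_on_subset[OF hol])
          (use \<rho> in auto)
      show "cmod (f x) \<le> M" if "cmod (w - x) = \<rho> / 2" for x
        using that \<rho> by (intro M) (auto simp: dist_norm)
    qed (use \<rho> in auto)
    then show ?thesis
      by (simp add: a_def norm_divide field_simps)
  qed
  have term_le: "cmod (a i * (z - w) ^ i) \<le> M * x ^ i" for i
  proof -
    have "cmod (a i * (z - w) ^ i) \<le> M / (\<rho> / 2) ^ i * cmod (z - w) ^ i"
      unfolding norm_mult norm_power by (intro mult_right_mono a) auto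
    also have "\<dots> = M * x ^ i"
      by (simp add: x_def power_divide power_mult_distrib field_simps)
    finally show ?thesis .
  qed
  have geo: "(\<lambda>i. M * x ^ (i + n)) sums (M * x ^ n * (1 / (1 - x)))"
    using sums_mult[OF geometric_sums[of x], of "M * x ^ n"] x
    by (simp add: power_add mult_ac)
  have "f z - (\<Sum>i<n. a i * (z - w) ^ i) = (\<Sum>i. a (i + n) * (z - w) ^ (i + n))"
    using sums_split_initial_segment[OF sums, of n] by (simp add: sums_iff)
  also have "cmod \<dots> \<le> (\<Sum>i. M * x ^ (i + n))"
    by (rule norm_suminf_le) (use term_le geo in \<open>auto simp: sums_iff\<close>)
  also have "\<dots> = M * x ^ n * (1 / (1 - x))"
    using geo by (simp add: sums_iff)
  also have "\<dots> \<le> M * x ^ n * 2"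
    by (rule mult_left_mono) (use x M0 in \<open>auto simp: field_simps\<close>)
  finally show ?thesis by (simp add: a_def x_def mult_ac)
qed

text \<open>Cauchy's inequality on a circle of radius s gives a bound of order s^(n-i), and s tends
  to 0. Orders of vanishing are kept as Landau symbols, which add and multiply easily; this lemma
  converts them back to Taylor coefficients.\<close>

lemma higher_deriv_eq_0_if_bigo:
  fixes f :: "complex \<Rightarrow> complex"
  assumes hol: "f holomorphic_on ball 0 \<rho>" and \<rho>: "\<rho> > 0"
    and f: "f \<in> O[at 0](\<lambda>z. z ^ n)" and i: "i < n"
  shows "(deriv ^^ i) f 0 = 0"
proof -
  obtain c where c: "c > 0" "eventually (\<lambda>z. cmod (f z) \<le> c * cmod (z ^ n)) (at 0)"
    using landau_o.bigE[OF f] by blast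
  then obtain d where d: "d > 0" "\<And>z. z \<noteq> 0 \<Longrightarrow> dist z 0 < d \<Longrightarrow> cmod (f z) \<le> c * cmod (z ^ n)"
    by (auto simp: eventually_at)
  have "cmod ((deriv ^^ i) f 0) \<le> (fact i * c) * s ^ (n - i)" if s: "0 < s" "s < min \<rho> d" for s
  proof -
    have "cmod ((deriv ^^ i) f 0) \<le> fact i * (c * s ^ n) / s ^ i"
    proof (rule Cauchy_inequality)
      show "f holomorphic_on ball 0 s"
        by (rule holomorphic_on_subset[OF hol]) (use s in auto)
      show "continuous_on (cball 0 s) f"
        by (rule holomorphic_on_imp_continuous_on, rule holomorphic_on_subset[OF hol])
          (use s in auto)
      show "cmod (f x) \<le> c * s ^ n" if "cmod (0 - x) = s" for x
        using d(2)[of x] that s by (auto simp: norm_power)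
    qed (use s in auto)
    also have "s ^ n = s ^ (n - i) * s ^ i"
      using i by (simp flip: power_add)
    finally show ?thesis using s by simp
  qed
  moreover have "eventually (\<lambda>s. 0 < s \<and> s < min \<rho> d) (at_right (0::real))"
    using \<rho> d(1) by (auto simp: eventually_at_right_field intro: exI[of _ "min \<rho> d"])
  ultimately have "eventually (\<lambda>s. cmod ((deriv ^^ i) f 0) \<le> (fact i * c) * s ^ (n - i)) (at_right 0)"
    by (auto elim: eventually_mono)
  moreover have "((\<lambda>s. (fact i * c) * s ^ (n - i)) \<longlongrightarrow> (fact i * c) * 0 ^ (n - i)) (at_right (0::real))"
    by (intro tendsto_intros)
  ultimately have "cmod ((deriv ^^ i) f 0) \<le> (fact i * c) * 0 ^ (n - i)"
    by (intro tendsto_lowerbound) auto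
  then show ?thesis using i by (simp add: power_0_left)
qed

text \<open>The implicit constant of the Landau symbol disappears: a function that vanishes to order
  n is controlled by its supremum \<open>M\<close> and \<rho> alone. This makes the estimate uniform
  over a family with a common supremum.\<close>

lemma vanishing_holomorphic_bound:
  fixes f :: "complex \<Rightarrow> complex"
  assumes hol: "f holomorphic_on ball 0 \<rho>" and \<rho>: "\<rho> > 0"
    and M: "\<And>z. z \<in> ball 0 \<rho> \<Longrightarrow> cmod (f z) \<le> M" and f: "f \<in> O[at 0](\<lambda>z. z ^ n)"
    and z: "cmod z \<le> \<rho> / 4"
  shows "cmod (f z) \<le> 2 * M * (2 / \<rho>) ^ n * cmod z ^ n"
proof -
  have "(\<Sum>i<n. (deriv ^^ i) f 0 / fact i * (z - 0) ^ i) = 0"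
    using higher_deriv_eq_0_if_bigo[OF hol \<rho> f] by (intro sum.neutral) auto
  then show ?thesis
    using taylor_remainder_bound[OF hol \<rho> M, of z n] z
    by (simp add: power_divide power_mult_distrib mult_ac)
qed

text \<open>Integrating once from 0, in the form of the mean value inequality on
  \<open>cball 0 (cmod z)\<close>, gains one order.\<close>

lemma bigo_power_Suc_if_deriv:
  fixes f f' :: "complex \<Rightarrow> complex"
  assumes der: "\<And>z. z \<in> ball 0 \<rho> \<Longrightarrow> (f has_field_derivative f' z) (at z)" and \<rho>: "\<rho> > 0"
    and f0: "f 0 = 0" and f': "f' \<in> O[at 0](\<lambda>z. z ^ n)"
  shows "f \<in> O[at 0](\<lambda>z. z ^ Suc n)"
proof -
  obtain c where c: "c > 0" "eventually (\<lambda>z. cmod (f' z) \<le> c * cmod (z ^ n)) (at 0)"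
    using landau_o.bigE[OF f'] by blast
  then obtain d where d: "d > 0" "\<And>z. z \<noteq> 0 \<Longrightarrow> cmod z < d \<Longrightarrow> cmod (f' z) \<le> c * cmod z ^ n"
    by (auto simp: eventually_at norm_power)
  have hol: "f holomorphic_on ball 0 \<rho>"
    using der unfolding holomorphic_on_open[OF open_ball] by blast
  \<comment> \<open>The filter \<open>at 0\<close> leaves out the point 0, but the mean value
    inequality needs the bound on \<open>f'\<close> there as well. It follows by continuity, since
    \<open>f'\<close> is the derivative of a holomorphic function.\<close>
  have "continuous_on (ball 0 \<rho>) (deriv f)"
    by (intro holomorphic_on_imp_continuous_on holomorphic_deriv hol) auto
  then have "continuous_on (ball 0 \<rho>) f'"
    by (rule continuous_on_eq) (use der DERIV_imp_deriv in blast)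
  then have "isCont f' 0"
    using \<rho> by (simp add: continuous_on_eq_continuous_at)
  then have lim: "((\<lambda>z. cmod (f' z)) \<longlongrightarrow> cmod (f' 0)) (at 0)"
    unfolding isCont_def by (rule tendsto_norm)
  have "cmod (f' 0) \<le> c * cmod 0 ^ n"
  proof (rule tendsto_le[OF _ _ lim])
    show "((\<lambda>z. c * cmod z ^ n) \<longlongrightarrow> c * cmod 0 ^ n) (at 0)" by (intro tendsto_intros)
  qed (use c in \<open>auto simp: norm_power\<close>)
  with d have bound: "cmod (f' z) \<le> c * cmod z ^ n" if "cmod z < d" for z
    using that by (cases "z = 0") auto
  have "cmod (f z) \<le> c * cmod (z ^ Suc n)" if z: "cmod z < min d \<rho>" for z
  proof -
    have "cmod (f z - f 0) \<le> c * cmod z ^ n * cmod (z - 0)"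
    proof (rule field_differentiable_bound)
      show "(f has_field_derivative f' w) (at w within cball 0 (cmod z))" if "w \<in> cball 0 (cmod z)" for w
        using that z by (intro has_field_derivative_at_within[OF der]) auto
      show "cmod (f' w) \<le> c * cmod z ^ n" if "w \<in> cball 0 (cmod z)" for w
      proof -
        have "cmod (f' w) \<le> c * cmod w ^ n" using bound[of w] that z by auto
        also have "\<dots> \<le> c * cmod z ^ n"
          using that c by (intro mult_left_mono power_mono) auto
        finally show ?thesis .
      qed
    qed auto
    then show ?thesis using f0 by (simp add: norm_mult norm_power mult_ac)
  qed
  then have "eventually (\<lambda>z. cmod (f z) \<le> c * cmod (z ^ Suc n)) (at 0)"
    unfolding eventually_at using \<rho> d(1) by (intro exI[of _ "min d \<rho>"]) auto
  then show ?thesis by (rule landau_o.bigI[OF c(1)])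
qed

section \<open>Lattice sums and the Leray projection\<close>

lemma kabs_L2_set: "kabs k = L2_set (\<lambda>i. real_of_int (k $ i)) UNIV"
  by (simp add: kabs_def ksq_def L2_set_def)

lemma kabs_nonneg [simp]: "0 \<le> kabs k"
  by (simp add: kabs_L2_set)

lemma kabs_0 [simp]: "kabs 0 = 0"
  by (simp add: kabs_def ksq_def)

lemma kabs_power2: "(kabs k)\<^sup>2 = ksq k"
  by (simp add: kabs_def ksq_def sum_nonneg)

lemma kabs_triangle: "kabs (k + l) \<le> kabs k + kabs l"
  using L2_set_triangle_ineq[of "\<lambda>i. real_of_int (k $ i)" "\<lambda>i. real_of_int (l $ i)" UNIV]
  by (simp add: kabs_L2_set)

lemma abs_component_le_kabs: "\<bar>real_of_int (k $ i)\<bar> \<le> kabs k"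
  using member_le_L2_set[of UNIV i "\<lambda>i. \<bar>real_of_int (k $ i)\<bar>"]
  by (simp add: kabs_L2_set L2_set_def)

lemma kabs_ge_1:
  assumes "k \<noteq> 0"
  shows "1 \<le> kabs k"
proof -
  obtain i where "k $ i \<noteq> 0" using assms by (metis vec_eq_iff zero_index)
  then have "1 \<le> \<bar>real_of_int (k $ i)\<bar>" by linarith
  then show ?thesis using abs_component_le_kabs[of k i] by linarith
qed

text \<open>The \<open>max 1\<close> gives the term at 0 the value 1, where \<open>0 powr s\<close>
  would be 0: the product of these terms over the components has to dominate at lattice points with
  zero components too.\<close>

lemma summable_on_int_powr:
  assumes "s < -1"
  shows "(\<lambda>m::int. (max 1 \<bar>real_of_int m\<bar>) powr s) summable_on UNIV"
proof -
  let ?h = "\<lambda>m::int. (max 1 \<bar>real_of_int m\<bar>) powr s"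
  have "summable (\<lambda>n. real n powr s)" using assms by (simp add: summable_real_powr_iff)
  then have "summable (\<lambda>n. real (n + 1) powr s)" using summable_ignore_initial_segment by blast
  then have "summable (\<lambda>n. ?h (int (n + 1)))" by (simp add: max_def)
  then have "summable (\<lambda>n. ?h (int n))" using summable_Suc_iff[of "\<lambda>n. ?h (int n)"] by simp
  then have 1: "(\<lambda>n. ?h (int n)) summable_on UNIV"
    by (subst summable_on_UNIV_nonneg_real_iff) auto
  have "?h summable_on range int"
    by (subst summable_on_reindex) (use 1 in \<open>auto simp: o_def\<close>)
  moreover have "?h summable_on range (\<lambda>n. - int n)"
    by (subst summable_on_reindex) (use 1 in \<open>auto simp: o_def inj_on_def\<close>)
  ultimately have "?h summable_on (range int \<union> range (\<lambda>n. - int n))"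
    by (rule summable_on_union)
  moreover have "range int \<union> range (\<lambda>n. - int n) = UNIV"
    by (auto simp: image_iff) (metis int_cases2)
  ultimately show ?thesis by simp
qed

text \<open>Its square root is |k| to the power -(d+1)/2, which the threshold r > (d + 1) / 2 allows
  |k|^r to compensate; the exponent is above d, as summability over the lattice requires.\<close>

definition lattice_weight :: "int^'d::finite \<Rightarrow> real" where
  "lattice_weight k = (if k = 0 then 0 else kabs k powr - (real CARD('d) + 1))"

lemma lattice_weight_nonneg [simp]: "0 \<le> lattice_weight k"
  by (simp add: lattice_weight_def)

text \<open>With s = -(d+1)/d < -1 the weight is the product of d copies of |k|^s. Since |k| is at
  least 1 and at least every component, each copy is bounded by a one-dimensional term, and the
  lattice sum becomes a product of d convergent sums.\<close>

lemma lattice_weight_summable: "(lattice_weight :: int^'d::finite \<Rightarrow> real) summable_on UNIV"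
proof -
  define d where "d = real CARD('d)"
  have d: "d > 0" by (simp add: d_def)
  define s where "s = - (d + 1) / d"
  have s: "s < -1" using d by (simp add: s_def field_simps)
  define h where "h m = (max 1 \<bar>real_of_int m\<bar>) powr s" for m :: int
  have "Infinite_Set_Sum.abs_summable_on (\<lambda>f. \<Prod>i\<in>(UNIV :: 'd set). h (f i)) (PiE UNIV (\<lambda>_. UNIV))"
    using summable_on_int_powr[OF s]
    by (intro Infinite_Set_Sum.abs_summable_on_prod_PiE)
      (auto simp: h_def abs_summable_equivalent[symmetric])
  then have "(\<lambda>f. \<Prod>i\<in>(UNIV :: 'd set). h (f i)) summable_on UNIV"
    by (simp add: abs_summable_equivalent[symmetric] prod_norm[symmetric] h_def abs_prod)
  moreover have "bij_betw (vec_nth :: int^'d \<Rightarrow> _) UNIV UNIV"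
    by (rule bij_betwI[where g = vec_lambda]) auto
  ultimately have sum: "(\<lambda>k::int^'d. \<Prod>i\<in>UNIV. h (k $ i)) summable_on UNIV"
    using summable_on_reindex_bij_betw[of vec_nth UNIV UNIV "\<lambda>f. \<Prod>i\<in>(UNIV :: 'd set). h (f i)"] by auto
  have le: "lattice_weight k \<le> (\<Prod>i\<in>UNIV. h (k $ i))" for k :: "int^'d"
  proof (cases "k = 0")
    case False
    have "lattice_weight k = (kabs k powr s) ^ CARD('d)"
    proof -
      have "kabs k powr - (d + 1) = kabs k powr (s * d)" using d by (simp add: s_def mult.commute)
      also have "\<dots> = (kabs k powr s) ^ CARD('d)"
        using kabs_ge_1[OF False] by (simp add: d_def powr_power mult.commute)
      finally show ?thesis using False by (simp add: lattice_weight_def d_def)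
    qed
    also have "\<dots> = (\<Prod>i\<in>(UNIV :: 'd set). kabs k powr s)" by simp
    also have "\<dots> \<le> (\<Prod>i\<in>UNIV. h (k $ i))"
      unfolding h_def using s kabs_ge_1[OF False] abs_component_le_kabs[of k]
      by (intro prod_mono conjI powr_mono2') auto
    finally show ?thesis .
  qed (simp add: lattice_weight_def h_def prod_nonneg)
  show ?thesis
    by (rule nonneg_summable_mono[OF sum _ le]) simp
qed

section \<open>Gevrey weights and the size of a single Fourier mode\<close>

lemma gweight_0: "gweight r 0 k = (kabs k powr r)\<^sup>2"
  by (simp add: gweight_def power2_eq_square flip: powr_add)

lemma gweight_nonneg [simp]: "0 \<le> gweight r \<beta> k"
  by (simp add: gweight_def)

lemma kabs_power2_le_gweight:
  assumes "1 \<le> r"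
  shows "(kabs k)\<^sup>2 \<le> gweight r 0 k"
proof (cases "k = 0")
  case False
  have "(kabs k)\<^sup>2 = kabs k powr 2"
    using kabs_ge_1[OF False] by (simp add: powr_numeral)
  also have "\<dots> \<le> kabs k powr (2 * r)"
    using kabs_ge_1[OF False] assms by (intro powr_mono) auto
  finally show ?thesis by (simp add: gweight_def)
qed simp

lemma one_le_gweight:
  assumes "0 \<le> r" "k \<noteq> 0"
  shows "1 \<le> gweight r 0 k"
  using kabs_ge_1[OF assms(2)] assms(1) by (auto simp: gweight_def intro: ge_one_powr_ge_zero)

text \<open>The l^1 norm over components replaces the Euclidean one because it is additive: sums
  over components can be exchanged with lattice sums without loss.\<close>

definition vabs :: "'d::finite vf \<Rightarrow> int^'d \<Rightarrow> real" where
  "vabs F k = (\<Sum>n\<in>UNIV. cmod (F k n))"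

lemma vabs_nonneg [simp]: "0 \<le> vabs F k"
  by (simp add: vabs_def sum_nonneg)

lemma cmod_le_vabs: "cmod (F k n) \<le> vabs F k"
  unfolding vabs_def by (rule member_le_sum) auto

lemma cmod_sum_times_component:
  "cmod (\<Sum>m\<in>UNIV. F j m * of_int (k $ m)) \<le> vabs F j * kabs k"
proof -
  have "cmod (\<Sum>m\<in>UNIV. F j m * of_int (k $ m)) \<le> (\<Sum>m\<in>UNIV. cmod (F j m) * kabs k)"
    by (rule sum_norm_le) (auto simp: norm_mult intro!: mult_left_mono abs_component_le_kabs)
  then show ?thesis by (simp add: vabs_def sum_distrib_right)
qed

text \<open>Each component of the subtracted gradient part is at most |k| |k| / |k|^2 times the l^1
  norm; summing over d components gives the d in the constant.\<close>

lemma leray_bound: "vabs (leray F) k \<le> (1 + real CARD('d)) * vabs F (k :: int^'d::finite)"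
proof (cases "k = 0")
  case True
  then show ?thesis by (simp add: vabs_def leray_def sum_nonneg)
next
  case False
  have ksq: "ksq k = (kabs k)\<^sup>2" "kabs k \<ge> 1"
    using kabs_ge_1[OF False] by (auto simp: kabs_power2)
  have "cmod (leray F k n) \<le> cmod (F k n) + vabs F k" for n
  proof -
    have "cmod ((\<Sum>m\<in>UNIV. of_int (k $ m) * F k m) / complex_of_real (ksq k) * of_int (k $ n))
        \<le> (vabs F k * kabs k) / ksq k * kabs k"
      using cmod_sum_times_component[of F k k] abs_component_le_kabs[of k n] ksq
      unfolding norm_mult norm_divide norm_of_real norm_of_int mult.commute[of "of_int _"]
      by (intro mult_mono divide_mono) auto
    also have "\<dots> = vabs F k" using ksq by (simp add: power2_eq_square)
    finally show ?thesis
      using False by (simp add: leray_def) (meson add_left_mono norm_triangle_ineq4 order_trans)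
  qed
  then have "vabs (leray F) k \<le> (\<Sum>n\<in>(UNIV :: 'd set). cmod (F k n) + vabs F k)"
    unfolding vabs_def[of "leray F"] by (intro sum_mono)
  also have "\<dots> = (1 + real CARD('d)) * vabs F k"
    by (simp add: sum.distrib vabs_def algebra_simps)
  finally show ?thesis .
qed

lemma leray_divergence_free: "(\<Sum>m\<in>UNIV. of_int (k $ m) * leray F k m) = 0"
proof (cases "k = 0")
  case False
  have ne: "complex_of_real (ksq k) \<noteq> 0"
    using kabs_ge_1[OF False] by (simp flip: kabs_power2)
  let ?D = "\<Sum>m\<in>UNIV. of_int (k $ m) * F k m"
  have ksq: "(\<Sum>m\<in>UNIV. of_int (k $ m) * of_int (k $ m)) = complex_of_real (ksq k)"
    by (simp add: ksq_def power2_eq_square)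
  have "(\<Sum>m\<in>UNIV. of_int (k $ m) * leray F k m) =
      ?D - ?D / complex_of_real (ksq k) * (\<Sum>m\<in>UNIV. of_int (k $ m) * of_int (k $ m))"
    using False unfolding leray_def sum_distrib_left
    by (simp add: right_diff_distrib sum_subtractf mult_ac)
  then show ?thesis using ne unfolding ksq by simp
qed (simp add: leray_def)

lemma leray_diff: "leray (\<lambda>k n. F k n - G k n) k n = leray F k n - leray G k n"
  by (simp add: leray_def algebra_simps sum_subtractf diff_divide_distrib)

lemma vabs_times_e [simp]: "vabs (times_e e f) k = cmod (f k)"
  unfolding vabs_def times_e_def by (subst sum.remove[of _ e]) auto

section \<open>The majorant sequence\<close>

text \<open>These are the Taylor coefficients of the solution of m(x) = 1 + x (m(x)^2 / 8 + m(x) /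
  4). At x = 1 the quadratic has the roots 2 and 4, and the smaller one bounds the sum of the
  sequence.\<close>

fun majorant :: "nat \<Rightarrow> real" where
  "majorant 0 = 1"
| "majorant (Suc n) = (\<Sum>i\<le>n. majorant i * majorant (n - i)) / 8 + majorant n / 4"

declare majorant.simps(2) [simp del]

lemma majorant_nonneg [simp]: "0 \<le> majorant n"
proof (induction n rule: less_induct)
  case (less n)
  then show ?case
    by (cases n) (auto simp: majorant.simps intro!: sum_nonneg add_nonneg_nonneg mult_nonneg_nonneg)
qed

text \<open>The triangle i + j \<le> n lies in the square, so the double sum is at most the square
  of the previous partial sum, and 1 + 4/8 + 2/4 = 2 closes the induction.\<close>

lemma sum_majorant_le: "(\<Sum>i\<le>n. majorant i) \<le> 2"
proof (induction n)
  case (Suc n)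
  let ?S = "\<Sum>i\<le>n. majorant i"
  have "(\<Sum>m\<le>n. \<Sum>i\<le>m. majorant i * majorant (m - i))
      = (\<Sum>(i, j)\<in>{(i, j). i + j \<le> n}. majorant i * majorant j)"
    using sum.triangle_reindex_eq[of "\<lambda>i j. majorant i * majorant j" n] by simp
  also have "\<dots> \<le> (\<Sum>(i, j)\<in>{..n} \<times> {..n}. majorant i * majorant j)"
    by (rule sum_mono2) auto
  also have "\<dots> = ?S * ?S"
    by (simp add: sum_product sum.cartesian_product)
  also have "\<dots> \<le> 2 * 2"
    using Suc by (intro mult_mono sum_nonneg) auto
  finally have *: "(\<Sum>m\<le>n. \<Sum>i\<le>m. majorant i * majorant (m - i)) \<le> 4" by simp
  have "(\<Sum>i\<le>Suc n. majorant i) = 1 + (\<Sum>m\<le>n. majorant (Suc m))"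
    by (subst sum.atMost_Suc_shift) simp
  also have "\<dots> = 1 + (\<Sum>m\<le>n. \<Sum>i\<le>m. majorant i * majorant (m - i)) / 8 + ?S / 4"
    by (simp add: majorant.simps sum.distrib sum_divide_distrib)
  also have "\<dots> \<le> 2" using * Suc by simp
  finally show ?case .
qed simp

lemma majorant_summable: "summable majorant"
proof (rule summableI_nonneg_bounded)
  fix n
  have "(\<Sum>i<n. majorant i) \<le> (\<Sum>i\<le>n. majorant i)" by (rule sum_mono2) auto
  then show "(\<Sum>i<n. majorant i) \<le> 2" using sum_majorant_le[of n] by linarith
qed simp

text \<open>The summability premise inside \<open>rec\<close> is needed because a divergent \<open>infsum\<close> is \<open>0\<close>.\<close>

lemma majorant_bound:
  fixes p :: "nat \<Rightarrow> int^'d::finite \<Rightarrow> real"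
  assumes nn: "\<And>n k. 0 \<le> p n k" and pos: "\<beta> > 0" "R > 0" "D \<ge> 0" "G \<ge> 0" "P \<ge> 0"
    and init: "(\<lambda>k. exp (\<beta> * kabs k) * p 0 k) summable_on UNIV"
      "(\<Sum>\<^sub>\<infinity>k. exp (\<beta> * kabs k) * p 0 k) \<le> P"
    and rec: "\<And>n k. (\<And>i. i \<le> n \<Longrightarrow> (\<lambda>j. p i j * (kabs (k - j) * p (n - i) (k - j))) summable_on UNIV) \<Longrightarrow>
      real (Suc n) * p (Suc n) k
      \<le> D * (\<Sum>i\<le>n. \<Sum>\<^sub>\<infinity>j. p i j * (kabs (k - j) * p (n - i) (k - j))) + G * p n k"
    and small: "D * P * R \<le> \<beta> / 24" "G * R \<le> 1 / 4"
    and b: "0 \<le> b" "b < 1"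
  shows "(\<lambda>k. exp (b * \<beta> * kabs k) * p n k) summable_on UNIV \<and>
    (\<Sum>\<^sub>\<infinity>k. exp (b * \<beta> * kabs k) * p n k) \<le> P * majorant n / (R * (1 - b)) ^ n"
  using b
\<comment> \<open>All \<open>b\<close> are treated together because the bound at \<open>b\<close>
  uses the earlier terms at a larger weight \<open>c\<close>, which changes with the index.\<close>
proof (induction n arbitrary: b rule: less_induct)
  case (less m b)
  note b = less.prems
  show ?case
  proof (cases m)
    case 0
    have *: "exp (b * \<beta> * kabs k) * p 0 k \<le> exp (\<beta> * kabs k) * p 0 k" for k
      using b pos nn by (intro mult_right_mono) (auto simp: mult_left_le_one_le)
    then show ?thesis
      using nonneg_summable_mono[OF init(1) _ *] init(2) nn 0 by fastforce
  next
    case (Suc n)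
    \<comment> \<open>This step makes the accumulated loss \<open>((n + 2) / (n + 1)) ^ (n + 1) \<le> e\<close> independent of \<open>n\<close>.\<close>
    define c where "c = b + (1 - b) / (n + 2)"
    have c: "b < c" "c < 1" "0 \<le> c" "c - b = (1 - b) / (n + 2)" "1 - c = (1 - b) * ((n + 1) / (n + 2))"
      using b mult_strict_right_mono[of b 1 "1 + real n"] by (auto simp: c_def field_simps)
    define A where "A i k = exp (c * \<beta> * kabs k) * p i k" for i k
    define H where "H i k = (\<Sum>\<^sub>\<infinity>j. A i j * A (n - i) (k - j))" for i k
    have A: "A i summable_on UNIV" "infsum (A i) UNIV \<le> P * majorant i / (R * (1 - c)) ^ i"
      if "i \<le> n" for i
      using less.IH[of i c] that c Suc by (auto simp: A_def[abs_def])
    have A0: "0 \<le> A i k" for i k using nn by (simp add: A_def)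
    have H: "H i summable_on UNIV"
      "infsum (H i) UNIV \<le> P\<^sup>2 * (majorant i * majorant (n - i)) / (R * (1 - c)) ^ n" if i: "i \<le> n" for i
    proof -
      show "H i summable_on UNIV"
        unfolding H_def by (rule convolution_summable) (use A i A0 in auto)
      have "infsum (H i) UNIV = infsum (A i) UNIV * infsum (A (n - i)) UNIV"
        unfolding H_def by (rule convolution_summable) (use A i A0 in auto)
      also have "\<dots> \<le> (P * majorant i / (R * (1 - c)) ^ i) * (P * majorant (n - i) / (R * (1 - c)) ^ (n - i))"
        using c pos i by (intro mult_mono A infsum_nonneg A0) auto
      also have "\<dots> = P\<^sup>2 * (majorant i * majorant (n - i)) / ((R * (1 - c)) ^ i * (R * (1 - c)) ^ (n - i))"
        by (simp add: power2_eq_square mult_ac)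
      also have "(R * (1 - c)) ^ i * (R * (1 - c)) ^ (n - i) = (R * (1 - c)) ^ n"
        using i by (simp flip: power_add)
      finally show "infsum (H i) UNIV \<le> P\<^sup>2 * (majorant i * majorant (n - i)) / (R * (1 - c)) ^ n" .
    qed
    \<comment> \<open>This price of one derivative equals (n + 2) / (\<beta> (1 - b)). Divided by
      the \<open>Suc n\<close> of the recursion it leaves (n + 2) / (n + 1), the one factor missing
      from the power that is bounded by e.\<close>
    define \<kappa> where "\<kappa> = 1 / (\<beta> * (c - b))"
    have \<kappa>: "\<kappa> > 0" using c pos by (simp add: \<kappa>_def)
    have conv_summable: "(\<lambda>j. p i j * (kabs (k - j) * p (n - i) (k - j))) summable_on UNIV" (is ?sum)
      and conv: "exp (b * \<beta> * kabs k) * (\<Sum>\<^sub>\<infinity>j. p i j * (kabs (k - j) * p (n - i) (k - j))) \<le> \<kappa> * H i k"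
      if i: "i \<le> n" for i k
    proof -
      let ?t = "\<lambda>j. exp (b * \<beta> * kabs k) * (p i j * (kabs (k - j) * p (n - i) (k - j)))"
      have le: "?t j \<le> \<kappa> * (A i j * A (n - i) (k - j))" for j
      proof -
        let ?l = "kabs (k - j)"
        have "kabs k \<le> kabs j + ?l" using kabs_triangle[of j "k - j"] by simp
        then have "exp (b * \<beta> * kabs k) \<le> exp (b * \<beta> * kabs j) * exp (b * \<beta> * ?l)"
          using b pos by (simp flip: exp_add distrib_left add: mult_left_mono)
        \<comment> \<open>The undifferentiated factor is raised to the weight \<open>c\<close>
          merely to match the other one; the gap from \<open>b\<close> to \<open>c\<close> is spent
          on the factor that carries \<open>?l\<close>.\<close>
        also have "\<dots> \<le> exp (c * \<beta> * kabs j) * exp (b * \<beta> * ?l)"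
          using c pos by (intro mult_right_mono) (auto intro!: mult_right_mono)
        finally have 1: "exp (b * \<beta> * kabs k) \<le> exp (c * \<beta> * kabs j) * exp (b * \<beta> * ?l)" .
        have "\<beta> * (c - b) * ?l \<le> exp (\<beta> * (c - b) * ?l)"
          using exp_ge_add_one_self[of "\<beta> * (c - b) * ?l"] by linarith
        moreover have "\<beta> * (c - b) > 0" using c(1) pos by simp
        ultimately have "?l \<le> \<kappa> * exp (\<beta> * (c - b) * ?l)"
          unfolding \<kappa>_def by (simp add: pos_le_divide_eq mult.commute)
        then have "exp (b * \<beta> * ?l) * ?l \<le> exp (b * \<beta> * ?l) * (\<kappa> * exp (\<beta> * (c - b) * ?l))"
          by (intro mult_left_mono) auto
        also have "\<dots> = \<kappa> * exp (c * \<beta> * ?l)"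
          by (simp add: algebra_simps flip: exp_add)
        finally have 2: "exp (b * \<beta> * ?l) * ?l \<le> \<kappa> * exp (c * \<beta> * ?l)" .
        have "?t j \<le> exp (c * \<beta> * kabs j) * exp (b * \<beta> * ?l) * (p i j * (?l * p (n - i) (k - j)))"
          using nn by (intro mult_right_mono 1) auto
        also have "\<dots> = A i j * ((exp (b * \<beta> * ?l) * ?l) * p (n - i) (k - j))"
          by (simp add: A_def mult_ac)
        also have "\<dots> \<le> A i j * (\<kappa> * exp (c * \<beta> * ?l) * p (n - i) (k - j))"
          using nn A0 by (intro mult_left_mono mult_right_mono 2) auto
        finally show ?thesis by (simp add: A_def mult_ac)
      qed
      have AA: "(\<lambda>j. \<kappa> * (A i j * A (n - i) (k - j))) summable_on UNIV"
        by (intro summable_on_cmult_right convolution_summable) (use A A0 i in auto)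
      have "p i j * (kabs (k - j) * p (n - i) (k - j)) \<le> ?t j" for j
        using b pos nn mult_right_mono[of 1 "exp (b * \<beta> * kabs k)" "p i j * (kabs (k - j) * p (n - i) (k - j))"] by auto
      then show ?sum
        using nn by (intro nonneg_summable_mono(1)[OF AA] order_trans[OF _ le]) auto
      from AA have "(\<Sum>\<^sub>\<infinity>j. ?t j) \<le> (\<Sum>\<^sub>\<infinity>j. \<kappa> * (A i j * A (n - i) (k - j)))"
        by (rule nonneg_summable_mono[OF _ _ le]) (use nn in auto)
      then show "exp (b * \<beta> * kabs k) * (\<Sum>\<^sub>\<infinity>j. p i j * (kabs (k - j) * p (n - i) (k - j))) \<le> \<kappa> * H i k"
        by (simp add: infsum_cmult_right' H_def)
    qed
    have An: "(\<lambda>k. exp (b * \<beta> * kabs k) * p n k) summable_on UNIV"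
      "(\<Sum>\<^sub>\<infinity>k. exp (b * \<beta> * kabs k) * p n k) \<le> P * majorant n / (R * (1 - b)) ^ n"
      using less.IH[of n b] b Suc by auto
    define g where "g k = (D * (\<Sum>i\<le>n. \<kappa> * H i k) + G * (exp (b * \<beta> * kabs k) * p n k)) / real (Suc n)" for k
    have le: "exp (b * \<beta> * kabs k) * p m k \<le> g k" for k
    proof -
      have "exp (b * \<beta> * kabs k) * (real (Suc n) * p (Suc n) k) \<le> exp (b * \<beta> * kabs k) *
         (D * (\<Sum>i\<le>n. \<Sum>\<^sub>\<infinity>j. p i j * (kabs (k - j) * p (n - i) (k - j))) + G * p n k)"
        by (intro mult_left_mono rec conv_summable) auto
      also have "\<dots> = D * (\<Sum>i\<le>n. exp (b * \<beta> * kabs k) * (\<Sum>\<^sub>\<infinity>j. p i j * (kabs (k - j) * p (n - i) (k - j))))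
          + G * (exp (b * \<beta> * kabs k) * p n k)"
        by (simp add: algebra_simps sum_distrib_left)
      also have "\<dots> \<le> D * (\<Sum>i\<le>n. \<kappa> * H i k) + G * (exp (b * \<beta> * kabs k) * p n k)"
        using pos by (intro add_mono mult_left_mono sum_mono conv) auto
      finally show ?thesis by (simp add: g_def Suc field_simps)
    qed
    have "(H i has_sum infsum (H i) UNIV) UNIV" if "i \<in> {..n}" for i
      using H(1) that by auto
    then have gsum: "(g has_sum (D * (\<Sum>i\<le>n. \<kappa> * infsum (H i) UNIV)
        + G * (\<Sum>\<^sub>\<infinity>k. exp (b * \<beta> * kabs k) * p n k)) / real (Suc n)) UNIV"
      unfolding g_def using An(1)
      by (intro has_sum_divide_const has_sum_add has_sum_cmult_right has_sum_sum) auto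
    define T where "T = (\<Sum>i\<le>n. majorant i * majorant (n - i))"
    define X where "X = R * (1 - b)"
    have X: "X > 0" "X \<le> R" using b pos by (auto simp: X_def)
    have T: "T \<ge> 0" by (simp add: T_def sum_nonneg)
    have e: "((n + 2) / (n + 1)) ^ (n + 1) \<le> (3::real)"
    proof -
      have "((n + 2) / (n + 1)) ^ (n + 1) = (1 + 1 / real (n + 1)) ^ (n + 1)"
        by (simp add: field_simps)
      also have "\<dots> \<le> exp 1"
        by (rule exp_ge_one_plus_x_over_n_power_n) auto
      also have "\<dots> \<le> 3" by (rule exp_le)
      finally show ?thesis .
    qed
    have "infsum g UNIV = (D * (\<Sum>i\<le>n. \<kappa> * infsum (H i) UNIV)
        + G * (\<Sum>\<^sub>\<infinity>k. exp (b * \<beta> * kabs k) * p n k)) / real (Suc n)"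
      using gsum by (rule infsumI)
    also have "\<dots> \<le> (D * (\<Sum>i\<le>n. \<kappa> * (P\<^sup>2 * (majorant i * majorant (n - i)) / (R * (1 - c)) ^ n))
        + G * (P * majorant n / X ^ n)) / real (Suc n)"
      using pos \<kappa> An(2) H(2) unfolding X_def
      by (intro divide_right_mono add_mono mult_left_mono sum_mono) auto
    also have "\<dots> = D * \<kappa> * P\<^sup>2 * T / (R * (1 - c)) ^ n / real (Suc n) + G * (P * majorant n / X ^ n) / real (Suc n)"
      by (simp add: T_def sum_distrib_left sum_divide_distrib add_divide_distrib mult_ac)
    also have "D * \<kappa> * P\<^sup>2 * T / (R * (1 - c)) ^ n / real (Suc n)
        = (D * P * R / \<beta>) * ((n + 2) / (n + 1)) ^ (n + 1) * (P * T / X ^ Suc n)"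
    proof -
      define q where "q = ((n + 2) / (n + 1)) ^ n"
      have q: "q > 0" by (simp add: q_def)
      have "(R * (1 - c)) ^ n = X ^ n * ((n + 1) / (n + 2)) ^ n"
        unfolding c(5) X_def power_mult_distrib by simp
      also have "\<dots> = X ^ n / q"
        by (simp add: q_def power_divide)
      finally have 1: "(R * (1 - c)) ^ n = X ^ n / q" .
      have 2: "((n + 2) / (n + 1)) ^ (n + 1) = q * (real (n + 2) / real (Suc n))"
        by (simp add: q_def)
      have 3: "\<kappa> = real (n + 2) * R / (\<beta> * X)"
        using pos b by (simp add: \<kappa>_def c(4) X_def field_simps)
      show ?thesis
        unfolding 1 2 3 power_Suc power2_eq_square using q pos X(1)
        by (simp add: divide_simps mult_ac del: of_nat_Suc)
    qed
    \<comment> \<open>The 1/24 is the smallness assumption and 3 bounds e; together they give the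
      coefficient 1/8 of the quadratic term in \<open>majorant\<close>.\<close>
    also have "\<dots> \<le> (1 / 24) * 3 * (P * T / X ^ Suc n)"
      using pos X T by (intro mult_mono mult_nonneg_nonneg e) (use small in \<open>auto simp: field_simps\<close>)
    also have "G * (P * majorant n / X ^ n) / real (Suc n) \<le> G * (P * majorant n / X ^ n)"
    proof -
      have "0 \<le> G * (P * majorant n / X ^ n)" using pos X by auto
      from divide_left_mono[OF _ this, of 1 "real (Suc n)"] show ?thesis by simp
    qed
    also have "\<dots> = (G * X) * (P * majorant n / X ^ Suc n)"
      using X by (simp add: field_simps)
    also have "\<dots> \<le> 1 / 4 * (P * majorant n / X ^ Suc n)"
    proof (rule mult_right_mono)
      show "G * X \<le> 1 / 4" using small(2) mult_left_mono[OF X(2) pos(4)] by linarith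
    qed (use pos X in auto)
    finally have "infsum g UNIV \<le> P * majorant m / X ^ m"
      by (simp add: Suc majorant.simps T_def add_divide_distrib algebra_simps)
    then show ?thesis
      using nonneg_summable_mono[OF has_sum_imp_summable[OF gsum] _ le] nn unfolding X_def by fastforce
  qed
qed

section \<open>Holomorphy in the Sobolev norm\<close>

lemma sf_gev_add: "sf_gev r \<beta> f \<Longrightarrow> sf_gev r \<beta> g \<Longrightarrow> sf_gev r \<beta> (\<lambda>k. f k + g k)"
proof -
  assume "sf_gev r \<beta> f" "sf_gev r \<beta> g"
  then have "(\<lambda>k. 2 * (gweight r \<beta> k * (cmod (f k))\<^sup>2) + 2 * (gweight r \<beta> k * (cmod (g k))\<^sup>2)) summable_on UNIV"
    unfolding sf_gev_def by (intro summable_on_add summable_on_cmult_right)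
  then show ?thesis
    unfolding sf_gev_def
  proof (rule nonneg_summable_mono(1))
    fix k
    have "(cmod (f k + g k))\<^sup>2 \<le> (cmod (f k) + cmod (g k))\<^sup>2"
      by (intro power_mono norm_triangle_ineq) auto
    also have "\<dots> \<le> 2 * (cmod (f k))\<^sup>2 + 2 * (cmod (g k))\<^sup>2"
      using sum_squares_ge_zero[of "cmod (f k) - cmod (g k)" 0]
      by (simp add: power2_eq_square algebra_simps)
    finally have "gweight r \<beta> k * (cmod (f k + g k))\<^sup>2 \<le> gweight r \<beta> k * (2 * (cmod (f k))\<^sup>2 + 2 * (cmod (g k))\<^sup>2)"
      by (intro mult_left_mono) auto
    then show "gweight r \<beta> k * (cmod (f k + g k))\<^sup>2
        \<le> 2 * (gweight r \<beta> k * (cmod (f k))\<^sup>2) + 2 * (gweight r \<beta> k * (cmod (g k))\<^sup>2)"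
      by (simp add: algebra_simps)
  qed auto
qed

lemma sf_gev_cmult: "sf_gev r \<beta> f \<Longrightarrow> sf_gev r \<beta> (\<lambda>k. c * f k)"
  unfolding sf_gev_def
  using summable_on_cmult_right[of "\<lambda>k. gweight r \<beta> k * (cmod (f k))\<^sup>2" UNIV "(cmod c)\<^sup>2"]
  by (simp add: norm_mult power_mult_distrib mult_ac)

lemma sf_gev_diff_quotient:
  assumes "sf_gev r \<beta> a" "sf_gev r \<beta> b" "sf_gev r \<beta> w"
  shows "sf_gev r \<beta> (\<lambda>k. (a k - b k) / h - w k)"
proof -
  have "sf_gev r \<beta> (\<lambda>k. inverse h * (a k + (-1) * b k) + (-1) * w k)"
    by (intro sf_gev_add sf_gev_cmult assms)
  then show ?thesis by (simp add: field_simps)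
qed

lemma sf_gnorm2_nonneg: "0 \<le> sf_gnorm2 r \<beta> f"
  by (auto simp: sf_gnorm2_def intro!: mult_nonneg_nonneg infsum_nonneg)

lemma vf_gev_component: "vf_gev r \<beta> F \<Longrightarrow> sf_gev r \<beta> (\<lambda>k. F k n)"
  unfolding vf_gev_def sf_gev_def
  by (erule nonneg_summable_mono) (auto intro!: mult_left_mono member_le_sum)

lemma
  assumes "\<And>n. sf_gev r \<beta> (\<lambda>k. F k n)"
  shows vf_gev_if_components: "vf_gev r \<beta> F"
    and vf_gnorm2_eq_sum: "vf_gnorm2 r \<beta> F = (\<Sum>n\<in>UNIV. sf_gnorm2 r \<beta> (\<lambda>k. F k n))"
proof -
  have "((\<lambda>k. \<Sum>n\<in>UNIV. gweight r \<beta> k * (cmod (F k n))\<^sup>2) has_sum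
      (\<Sum>n\<in>UNIV. \<Sum>\<^sub>\<infinity>k. gweight r \<beta> k * (cmod (F k n))\<^sup>2)) UNIV"
    using assms by (intro has_sum_sum) (auto simp: sf_gev_def)
  then have *: "((\<lambda>k. gweight r \<beta> k * (\<Sum>n\<in>UNIV. (cmod (F k n))\<^sup>2)) has_sum
      (\<Sum>n\<in>UNIV. \<Sum>\<^sub>\<infinity>k. gweight r \<beta> k * (cmod (F k n))\<^sup>2)) UNIV"
    by (simp add: sum_distrib_left)
  show "vf_gev r \<beta> F" unfolding vf_gev_def using * by (rule has_sum_imp_summable)
  show "vf_gnorm2 r \<beta> F = (\<Sum>n\<in>UNIV. sf_gnorm2 r \<beta> (\<lambda>k. F k n))"
    using infsumI[OF *] by (simp add: vf_gnorm2_def sf_gnorm2_def sum_distrib_left)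
qed

lemma eventually_add_mem_at_0:
  fixes S :: "complex set"
  assumes "open S" "\<zeta> \<in> S"
  shows "eventually (\<lambda>h. \<zeta> + h \<in> S) (at 0)"
proof -
  have "((\<lambda>h. \<zeta> + h) \<longlongrightarrow> \<zeta> + 0) (at 0)" by (intro tendsto_intros)
  then show ?thesis using assms by (auto dest: topological_tendstoD)
qed

text \<open>The squared vector norm is the sum of the squared component norms, provided that these
  are finite: a divergent \<open>infsum\<close> is 0 and would break the identity. Openness of
  \<open>S\<close> ensures finiteness of the difference quotients for all small
  \<open>h\<close>.\<close>

lemma hol_vf_iff_components:
  assumes S: "open S"
  shows "hol_vf r S U \<longleftrightarrow> (\<forall>n. hol_sf r S (\<lambda>z k. U z k n))"
proof
  assume U: "hol_vf r S U"
  show "\<forall>n. hol_sf r S (\<lambda>z k. U z k n)"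
    unfolding hol_sf_def
  proof (intro allI ballI conjI)
    fix n \<zeta> assume \<zeta>: "\<zeta> \<in> S"
    have gev: "vf_gev r 0 (U z)" if "z \<in> S" for z using U that by (simp add: hol_vf_def)
    show "sf_gev r 0 (\<lambda>k. U \<zeta> k n)" using gev[OF \<zeta>] by (rule vf_gev_component)
    obtain W where W: "vf_gev r 0 W"
      "((\<lambda>h. vf_gnorm2 r 0 (\<lambda>k n. (U (\<zeta>+h) k n - U \<zeta> k n) / h - W k n)) \<longlongrightarrow> 0) (at 0)"
      using U \<zeta> by (auto simp: hol_vf_def)
    have "eventually (\<lambda>h. sf_gnorm2 r 0 (\<lambda>k. (U (\<zeta>+h) k n - U \<zeta> k n) / h - W k n)
        \<le> vf_gnorm2 r 0 (\<lambda>k n. (U (\<zeta>+h) k n - U \<zeta> k n) / h - W k n)) (at 0)"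
      using eventually_add_mem_at_0[OF S \<zeta>]
    proof eventually_elim
      case (elim h)
      have "sf_gev r 0 (\<lambda>k. (U (\<zeta>+h) k n - U \<zeta> k n) / h - W k n)" for n
        by (intro sf_gev_diff_quotient vf_gev_component gev W elim \<zeta>)
      from vf_gnorm2_eq_sum[of r 0 "\<lambda>k n. (U (\<zeta>+h) k n - U \<zeta> k n) / h - W k n", OF this]
      show ?case by (auto intro!: member_le_sum sf_gnorm2_nonneg)
    qed
    then have "((\<lambda>h. sf_gnorm2 r 0 (\<lambda>k. (U (\<zeta>+h) k n - U \<zeta> k n) / h - W k n)) \<longlongrightarrow> 0) (at 0)"
      by (intro tendsto_sandwich[OF _ _ tendsto_const W(2)]) (auto simp: sf_gnorm2_nonneg)
    then show "\<exists>w. sf_gev r 0 w \<and>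
        ((\<lambda>h. sf_gnorm2 r 0 (\<lambda>k. (U (\<zeta>+h) k n - U \<zeta> k n) / h - w k)) \<longlongrightarrow> 0) (at 0)"
      using vf_gev_component[OF W(1), of n] by blast
  qed
next
  assume U: "\<forall>n. hol_sf r S (\<lambda>z k. U z k n)"
  show "hol_vf r S U"
    unfolding hol_vf_def
  proof (intro ballI conjI)
    fix \<zeta> assume \<zeta>: "\<zeta> \<in> S"
    have gev: "sf_gev r 0 (\<lambda>k. U z k n)" if "z \<in> S" for z n
      using U that by (simp add: hol_sf_def)
    show "vf_gev r 0 (U \<zeta>)" using gev[OF \<zeta>] by (rule vf_gev_if_components)
    have "\<forall>n. \<exists>w. sf_gev r 0 w \<and>
        ((\<lambda>h. sf_gnorm2 r 0 (\<lambda>k. (U (\<zeta>+h) k n - U \<zeta> k n) / h - w k)) \<longlongrightarrow> 0) (at 0)"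
      using U \<zeta> by (auto simp: hol_sf_def)
    from choice[OF this] obtain w where w: "\<And>n. sf_gev r 0 (w n)"
      "\<And>n. ((\<lambda>h. sf_gnorm2 r 0 (\<lambda>k. (U (\<zeta>+h) k n - U \<zeta> k n) / h - w n k)) \<longlongrightarrow> 0) (at 0)"
      by blast
    have "((\<lambda>h. \<Sum>n\<in>UNIV. sf_gnorm2 r 0 (\<lambda>k. (U (\<zeta>+h) k n - U \<zeta> k n) / h - w n k)) \<longlongrightarrow> 0) (at 0)"
      by (rule tendsto_null_sum) (rule w(2))
    moreover have "eventually (\<lambda>h. (\<Sum>n\<in>UNIV. sf_gnorm2 r 0 (\<lambda>k. (U (\<zeta>+h) k n - U \<zeta> k n) / h - w n k))
        = vf_gnorm2 r 0 (\<lambda>k n. (U (\<zeta>+h) k n - U \<zeta> k n) / h - w n k)) (at 0)"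
      using eventually_add_mem_at_0[OF S \<zeta>]
    proof eventually_elim
      case (elim h)
      show ?case
        by (rule vf_gnorm2_eq_sum[symmetric]) (intro sf_gev_diff_quotient gev w elim \<zeta>)
    qed
    ultimately have "((\<lambda>h. vf_gnorm2 r 0 (\<lambda>k n. (U (\<zeta>+h) k n - U \<zeta> k n) / h - w n k)) \<longlongrightarrow> 0) (at 0)"
      by (auto elim: Lim_transform_eventually)
    moreover have "vf_gev r 0 (\<lambda>k n. w n k)"
      by (rule vf_gev_if_components) (rule w(1))
    ultimately show "\<exists>W. vf_gev r 0 W \<and>
        ((\<lambda>h. vf_gnorm2 r 0 (\<lambda>k n. (U (\<zeta>+h) k n - U \<zeta> k n) / h - W k n)) \<longlongrightarrow> 0) (at 0)"
      by blast
  qed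
qed

section \<open>From exponentially weighted l^1 bounds to Sobolev norms\<close>

text \<open>The inequality ln x \<le> x at x = s |k| / r, multiplied by r and exponentiated, gives
  the constant (r / s)^r.\<close>

lemma kabs_powr_le_exp:
  assumes "s > 0" "r > 0"
  obtains C where "C > 0" "\<And>k :: int^'d::finite. kabs k powr r \<le> C * exp (s * kabs k)"
proof
  show "exp (r * ln (r / s)) > 0" by simp
  fix k :: "int^'d"
  show "kabs k powr r \<le> exp (r * ln (r / s)) * exp (s * kabs k)"
  proof (cases "k = 0")
    case False
    then have k: "kabs k > 0" using kabs_ge_1[of k] by linarith
    have "ln (kabs k) = ln (s / r * kabs k) + ln (r / s)"
      using k assms by (simp add: ln_mult ln_div)
    also have "ln (s / r * kabs k) \<le> s / r * kabs k"
      using ln_le_minus_one[of "s / r * kabs k"] k assms by simp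
    finally have "r * ln (kabs k) \<le> r * (s / r * kabs k + ln (r / s))"
      using assms by (intro mult_left_mono) auto
    then show ?thesis
      using k assms by (simp add: powr_def algebra_simps flip: exp_add)
  qed simp
qed

text \<open>A nonnegative summable sequence is bounded by its sum \<open>B\<close>, so its square is
  at most \<open>B\<close> times the sequence itself; the power |k|^r is absorbed by the exponential
  weight.\<close>

lemma gweight_square_summable:
  fixes q :: "int^'d::finite \<Rightarrow> real"
  assumes s: "s > 0" and r: "r > 0" and q: "\<And>k. 0 \<le> q k"
    and sum: "(\<lambda>k. exp (s * kabs k) * q k) summable_on UNIV"
  shows "(\<lambda>k. gweight r 0 k * (q k)\<^sup>2) summable_on UNIV"
proof -
  obtain C where C: "C > 0" "\<And>k :: int^'d. kabs k powr r \<le> C * exp (s * kabs k)"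
    using kabs_powr_le_exp[OF s r] by blast
  define e where "e k = exp (s * kabs k) * q k" for k
  define B where "B = infsum e UNIV"
  have e: "e summable_on UNIV" "\<And>k. 0 \<le> e k" using sum q by (auto simp: e_def[abs_def])
  have eB: "e k \<le> B" for k
    using finite_sum_le_infsum[of e UNIV "{k}"] e by (simp add: B_def)
  have "(\<lambda>k. (C\<^sup>2 * B) * e k) summable_on UNIV"
    by (intro summable_on_cmult_right e)
  then show ?thesis
  proof (rule nonneg_summable_mono(1))
    fix k
    have "kabs k powr r * q k \<le> C * e k"
      using mult_right_mono[OF C(2) q, of k k] by (simp add: e_def mult_ac)
    then have "(kabs k powr r * q k)\<^sup>2 \<le> (C * e k)\<^sup>2"
      using q by (intro power_mono) auto
    also have "\<dots> = C\<^sup>2 * (e k * e k)" by (simp add: power2_eq_square mult_ac)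
    also have "\<dots> \<le> C\<^sup>2 * (B * e k)"
      using eB e by (intro mult_left_mono mult_right_mono) auto
    finally show "gweight r 0 k * (q k)\<^sup>2 \<le> (C\<^sup>2 * B) * e k"
      by (simp add: gweight_0 power_mult_distrib mult.assoc)
  qed auto
qed

text \<open>The Taylor remainder of order 2 bounds the error of the difference quotient in mode k by
  (8 / \<tau>^2) |h| \<open>q k\<close>. One sequence \<open>q\<close> serves all modes and all
  nearby points, so the squared norm of the error is O(|h|^2).\<close>

lemma hol_sf_if_dominated:
  fixes f :: "complex \<Rightarrow> 'd::finite sf"
  assumes hol: "\<And>k. (\<lambda>z. f z k) holomorphic_on ball 0 R"
    and dom: "\<And>\<rho>. 0 < \<rho> \<Longrightarrow> \<rho> < R \<Longrightarrow> \<exists>q. (\<forall>z\<in>ball 0 \<rho>. \<forall>k. cmod (f z k) \<le> q k) \<and>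
      (\<lambda>k. gweight r 0 k * (q k)\<^sup>2) summable_on UNIV"
  shows "hol_sf r (ball 0 R) f"
  unfolding hol_sf_def
proof (intro ballI conjI)
  fix \<zeta> :: complex assume \<zeta>: "\<zeta> \<in> ball 0 R"
  define \<tau> where "\<tau> = (R - cmod \<zeta>) / 2"
  have \<tau>: "\<tau> > 0" "0 < cmod \<zeta> + \<tau>" "cmod \<zeta> + \<tau> < R"
  proof -
    have *: "cmod \<zeta> < R" "0 \<le> cmod \<zeta>" using \<zeta> by auto
    from * show "\<tau> > 0" by (simp add: \<tau>_def)
    with * show "0 < cmod \<zeta> + \<tau>" by linarith
    from * show "cmod \<zeta> + \<tau> < R" by (simp add: \<tau>_def field_simps)
  qed
  obtain q where q: "\<And>z k. z \<in> ball 0 (cmod \<zeta> + \<tau>) \<Longrightarrow> cmod (f z k) \<le> q k"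
    and qs: "(\<lambda>k. gweight r 0 k * (q k)\<^sup>2) summable_on UNIV"
    using dom[OF \<tau>(2,3)] by blast
  have sub: "ball \<zeta> \<tau> \<subseteq> ball 0 (cmod \<zeta> + \<tau>)" "ball \<zeta> \<tau> \<subseteq> ball 0 R"
  proof -
    have "cmod z \<le> cmod \<zeta> + dist \<zeta> z" for z
      using norm_triangle_ineq[of \<zeta> "z - \<zeta>"] by (simp add: dist_norm norm_minus_commute)
    then show *: "ball \<zeta> \<tau> \<subseteq> ball 0 (cmod \<zeta> + \<tau>)"
      by (smt (verit, best) dist_0_norm mem_ball subsetI)
    show "ball \<zeta> \<tau> \<subseteq> ball 0 R" using \<tau>(3) by (intro order_trans[OF *] subset_ball) simp
  qed
  have q\<zeta>: "cmod (f z k) \<le> q k" if "z \<in> ball \<zeta> \<tau>" for z k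
    using q sub that by blast
  have q0: "0 \<le> q k" for k using order_trans[OF norm_ge_zero q\<zeta>[of \<zeta> k]] \<tau> by simp
  have gev: "sf_gev r 0 g" if "\<And>k. cmod (g k) \<le> C * q k" for g C
    unfolding sf_gev_def
  proof (rule nonneg_summable_mono(1))
    show "(\<lambda>k. C\<^sup>2 * (gweight r 0 k * (q k)\<^sup>2)) summable_on UNIV"
      by (intro summable_on_cmult_right qs)
    fix k
    have "(cmod (g k))\<^sup>2 \<le> (C * q k)\<^sup>2" by (intro power_mono that) auto
    from mult_left_mono[OF this gweight_nonneg]
    show "gweight r 0 k * (cmod (g k))\<^sup>2 \<le> C\<^sup>2 * (gweight r 0 k * (q k)\<^sup>2)"
      by (simp add: power_mult_distrib mult_ac)
  qed auto
  show "sf_gev r 0 (f \<zeta>)" by (rule gev[of _ 1]) (use q\<zeta>[of \<zeta>] \<tau> in auto)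
  \<comment> \<open>The derivative in norm can only be the modewise one; Cauchy's inequality at
    radius \<tau> / 2 shows that it is dominated by \<open>q\<close> as well.\<close>
  define w where "w k = deriv (\<lambda>z. f z k) \<zeta>" for k
  have hol\<zeta>: "(\<lambda>z. f z k) holomorphic_on ball \<zeta> \<tau>" for k
    using hol sub(2) by (rule holomorphic_on_subset)
  have "cmod (w k) \<le> (2 / \<tau>) * q k" for k
  proof -
    have "cmod ((deriv ^^ 1) (\<lambda>z. f z k) \<zeta>) \<le> fact 1 * q k / (\<tau> / 2) ^ 1"
    proof (rule Cauchy_inequality)
      show "(\<lambda>z. f z k) holomorphic_on ball \<zeta> (\<tau> / 2)"
        by (rule holomorphic_on_subset[OF hol\<zeta>]) (use \<tau> in auto)
      show "continuous_on (cball \<zeta> (\<tau> / 2)) (\<lambda>z. f z k)"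
        by (rule holomorphic_on_imp_continuous_on, rule holomorphic_on_subset[OF hol\<zeta>])
          (use \<tau> in auto)
      show "cmod (f x k) \<le> q k" if "cmod (\<zeta> - x) = \<tau> / 2" for x
        using that \<tau> by (intro q\<zeta>) (auto simp: dist_norm)
    qed (use \<tau> in auto)
    then show ?thesis by (simp add: w_def mult.commute)
  qed
  then have gw: "sf_gev r 0 w" by (rule gev)
  define K where "K = (2 * pi) ^ CARD('d) * ((8 / \<tau>\<^sup>2)\<^sup>2 * (\<Sum>\<^sub>\<infinity>k. gweight r 0 k * (q k)\<^sup>2))"
  have bound: "sf_gnorm2 r 0 (\<lambda>k. (f (\<zeta>+h) k - f \<zeta> k) / h - w k) \<le> K * (cmod h)\<^sup>2"
    if h: "h \<noteq> 0" "cmod h \<le> \<tau> / 4" for h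
  proof -
    have 1: "cmod ((f (\<zeta>+h) k - f \<zeta> k) / h - w k) \<le> (8 / \<tau>\<^sup>2 * cmod h) * q k" for k
    proof -
      have "cmod (f (\<zeta>+h) k - (\<Sum>i<2. (deriv ^^ i) (\<lambda>z. f z k) \<zeta> / fact i * (\<zeta> + h - \<zeta>) ^ i))
          \<le> 2 * q k * (2 * cmod (\<zeta> + h - \<zeta>) / \<tau>) ^ 2"
        by (rule taylor_remainder_bound[OF hol\<zeta> \<tau>(1) q\<zeta>]) (use h in auto)
      then have *: "cmod (f (\<zeta>+h) k - f \<zeta> k - w k * h) \<le> 2 * q k * (2 * cmod h / \<tau>)\<^sup>2"
        by (simp add: numeral_2_eq_2 w_def algebra_simps)
      have "(f (\<zeta>+h) k - f \<zeta> k) / h - w k = (f (\<zeta>+h) k - f \<zeta> k - w k * h) / h"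
        using h by (simp add: field_simps)
      also have "cmod \<dots> \<le> 2 * q k * (2 * cmod h / \<tau>)\<^sup>2 / cmod h"
        unfolding norm_divide by (intro divide_right_mono *) auto
      also have "\<dots> = (8 / \<tau>\<^sup>2 * cmod h) * q k"
        using h by (simp add: power2_eq_square field_simps)
      finally show ?thesis .
    qed
    have "(\<Sum>\<^sub>\<infinity>k. gweight r 0 k * (cmod ((f (\<zeta>+h) k - f \<zeta> k) / h - w k))\<^sup>2)
        \<le> (\<Sum>\<^sub>\<infinity>k. (8 / \<tau>\<^sup>2 * cmod h)\<^sup>2 * (gweight r 0 k * (q k)\<^sup>2))"
    proof (rule nonneg_summable_mono(2))
      show "(\<lambda>k. (8 / \<tau>\<^sup>2 * cmod h)\<^sup>2 * (gweight r 0 k * (q k)\<^sup>2)) summable_on UNIV"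
        by (intro summable_on_cmult_right qs)
      fix k
      have "(cmod ((f (\<zeta>+h) k - f \<zeta> k) / h - w k))\<^sup>2 \<le> ((8 / \<tau>\<^sup>2 * cmod h) * q k)\<^sup>2"
        by (intro power_mono 1) auto
      from mult_left_mono[OF this gweight_nonneg[of r 0 k]]
      show "gweight r 0 k * (cmod ((f (\<zeta>+h) k - f \<zeta> k) / h - w k))\<^sup>2
        \<le> (8 / \<tau>\<^sup>2 * cmod h)\<^sup>2 * (gweight r 0 k * (q k)\<^sup>2)"
        by (simp only: power_mult_distrib[of "8 / \<tau>\<^sup>2 * cmod h" "q k"] mult.left_commute)
    qed auto
    also have "\<dots> = (8 / \<tau>\<^sup>2)\<^sup>2 * (\<Sum>\<^sub>\<infinity>k. gweight r 0 k * (q k)\<^sup>2) * (cmod h)\<^sup>2"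
      unfolding infsum_cmult_right' power_mult_distrib[of "8 / \<tau>\<^sup>2" "cmod h"] by (simp only: mult_ac)
    finally have "(\<Sum>\<^sub>\<infinity>k. gweight r 0 k * (cmod ((f (\<zeta>+h) k - f \<zeta> k) / h - w k))\<^sup>2)
        \<le> (8 / \<tau>\<^sup>2)\<^sup>2 * (\<Sum>\<^sub>\<infinity>k. gweight r 0 k * (q k)\<^sup>2) * (cmod h)\<^sup>2" .
    from mult_left_mono[OF this, of "(2 * pi) ^ CARD('d)"] show ?thesis
      unfolding sf_gnorm2_def K_def by (simp add: mult.assoc)
  qed
  have "((\<lambda>h. K * (cmod h)\<^sup>2) \<longlongrightarrow> K * (cmod 0)\<^sup>2) (at 0)"
    by (intro tendsto_intros)
  then have lim: "((\<lambda>h. K * (cmod h)\<^sup>2) \<longlongrightarrow> 0) (at 0)" by simp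
  have "((\<lambda>h. sf_gnorm2 r 0 (\<lambda>k. (f (\<zeta>+h) k - f \<zeta> k) / h - w k)) \<longlongrightarrow> 0) (at 0)"
  proof (rule tendsto_sandwich[OF _ _ tendsto_const lim])
    show "eventually (\<lambda>h. sf_gnorm2 r 0 (\<lambda>k. (f (\<zeta>+h) k - f \<zeta> k) / h - w k) \<le> K * (cmod h)\<^sup>2) (at 0)"
      unfolding eventually_at using \<tau> bound by (intro exI[of _ "\<tau> / 4"]) auto
  qed (auto simp: sf_gnorm2_nonneg)
  with gw show "\<exists>w. sf_gev r 0 w \<and>
      ((\<lambda>h. sf_gnorm2 r 0 (\<lambda>k. (f (\<zeta>+h) k - f \<zeta> k) / h - w k)) \<longlongrightarrow> 0) (at 0)"
    by blast
qed

text \<open>Differentiability in norm at the single point 0 is enough: f(h) = f(0) + h (D + w),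
  where the difference quotient error D has norm below 1 for small h. Uniqueness needs this uniform
  bound, since \<open>hol_sf\<close> by itself asserts finiteness pointwise.\<close>

lemma hol_sf_locally_bounded:
  fixes f :: "complex \<Rightarrow> 'd::finite sf"
  assumes S: "open S" "0 \<in> S" and f: "hol_sf r S f"
  obtains \<rho> K where "\<rho> > 0" "ball 0 \<rho> \<subseteq> S"
    "\<And>z. z \<in> ball 0 \<rho> \<Longrightarrow> (\<Sum>\<^sub>\<infinity>k. gweight r 0 k * (cmod (f z k))\<^sup>2) \<le> K"
proof -
  define \<Phi> where "\<Phi> g = (\<Sum>\<^sub>\<infinity>k. gweight r 0 k * (cmod (g k))\<^sup>2)" for g :: "'d sf"
  obtain w where w: "sf_gev r 0 w"
    "((\<lambda>h. sf_gnorm2 r 0 (\<lambda>k. (f (0+h) k - f 0 k) / h - w k)) \<longlongrightarrow> 0) (at 0)"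
    using f S by (auto simp: hol_sf_def)
  have gev: "sf_gev r 0 (f z)" if "z \<in> S" for z using f that by (simp add: hol_sf_def)
  have "eventually (\<lambda>h. sf_gnorm2 r 0 (\<lambda>k. (f h k - f 0 k) / h - w k) < 1) (at 0)"
    using order_tendstoD(2)[OF w(2), of 1] by simp
  then obtain \<delta> where \<delta>: "\<delta> > 0"
    "\<And>h. h \<noteq> 0 \<Longrightarrow> dist h 0 < \<delta> \<Longrightarrow> sf_gnorm2 r 0 (\<lambda>k. (f h k - f 0 k) / h - w k) < 1"
    unfolding eventually_at by blast
  obtain \<epsilon> where \<epsilon>: "\<epsilon> > 0" "ball 0 \<epsilon> \<subseteq> S" using S open_contains_ball by blast
  \<comment> \<open>The 3 comes from (a + b + c)^2 \<le> 3 (a^2 + b^2 + c^2), the 1 from the bound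
    on the error term, and taking |h| \<le> 1 removes the factors of \<open>h\<close>.\<close>
  define K where "K = 3 * (\<Phi> (f 0) + 1 + \<Phi> w)"
  have \<Phi>0: "0 \<le> \<Phi> g" for g by (auto simp: \<Phi>_def intro!: infsum_nonneg)
  have "\<Phi> (f h) \<le> K" if h: "h \<in> ball 0 (min 1 (min \<delta> \<epsilon>))" for h
  proof (cases "h = 0")
    case True
    then show ?thesis using \<Phi>0[of w] \<Phi>0[of "f 0"] by (simp add: K_def)
  next
    case False
    define D where "D k = (f h k - f 0 k) / h - w k" for k
    have hS: "h \<in> S" using h \<epsilon> by auto
    have D: "sf_gev r 0 D" unfolding D_def by (intro sf_gev_diff_quotient gev w S hS)
    have pi1: "1 \<le> (2 * pi) ^ CARD('d)" using pi_gt3 by (intro one_le_power) auto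
    have "(2 * pi) ^ CARD('d) * \<Phi> D \<le> 1"
      using \<delta>(2)[of h] h False by (simp add: sf_gnorm2_def \<Phi>_def D_def)
    then have D1: "\<Phi> D \<le> 1" using mult_right_mono[OF pi1 \<Phi>0[of D]] by linarith
    have sums: "(\<lambda>k. 3 * (gweight r 0 k * (cmod (f 0 k))\<^sup>2 + gweight r 0 k * (cmod (D k))\<^sup>2
        + gweight r 0 k * (cmod (w k))\<^sup>2)) summable_on UNIV"
      using D w gev[OF S(2)] unfolding sf_gev_def by (intro summable_on_cmult_right summable_on_add)
    have "\<Phi> (f h) \<le> (\<Sum>\<^sub>\<infinity>k. 3 * (gweight r 0 k * (cmod (f 0 k))\<^sup>2 + gweight r 0 k * (cmod (D k))\<^sup>2
        + gweight r 0 k * (cmod (w k))\<^sup>2))"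
      unfolding \<Phi>_def
    proof (rule nonneg_summable_mono(2)[OF sums])
      fix k
      have "f h k = f 0 k + h * D k + h * w k"
        using False by (simp add: D_def field_simps)
      then have "cmod (f h k) \<le> cmod (f 0 k) + cmod h * cmod (D k) + cmod h * cmod (w k)"
        by (metis norm_mult norm_triangle_mono norm_triangle_ineq order_refl)
      also have "\<dots> \<le> cmod (f 0 k) + 1 * cmod (D k) + 1 * cmod (w k)"
        using h by (intro add_mono mult_right_mono) auto
      finally have "(cmod (f h k))\<^sup>2 \<le> (cmod (f 0 k) + cmod (D k) + cmod (w k))\<^sup>2"
        by (intro power_mono) auto
      also have "\<dots> \<le> 3 * ((cmod (f 0 k))\<^sup>2 + (cmod (D k))\<^sup>2 + (cmod (w k))\<^sup>2)"
        using sum_squares_ge_zero[of "cmod (f 0 k) - cmod (D k)" "cmod (D k) - cmod (w k)"]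
          zero_le_square[of "cmod (f 0 k) - cmod (w k)"]
        by (simp add: power2_eq_square algebra_simps)
      finally have "gweight r 0 k * (cmod (f h k))\<^sup>2 \<le> gweight r 0 k * (3 * ((cmod (f 0 k))\<^sup>2 + (cmod (D k))\<^sup>2 + (cmod (w k))\<^sup>2))"
        by (intro mult_left_mono) auto
      then show "gweight r 0 k * (cmod (f h k))\<^sup>2 \<le> 3 * (gweight r 0 k * (cmod (f 0 k))\<^sup>2
          + gweight r 0 k * (cmod (D k))\<^sup>2 + gweight r 0 k * (cmod (w k))\<^sup>2)"
        by (simp add: algebra_simps)
    qed auto
    also have "\<dots> = 3 * (\<Phi> (f 0) + \<Phi> D + \<Phi> w)"
      using D w(1) gev[OF S(2)] unfolding sf_gev_def \<Phi>_def infsum_cmult_right'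
      by (simp add: infsum_add summable_on_add)
    also have "\<dots> \<le> K" using D1 by (simp add: K_def)
    finally show ?thesis .
  qed
  moreover have "min 1 (min \<delta> \<epsilon>) > 0" "ball 0 (min 1 (min \<delta> \<epsilon>)) \<subseteq> S"
    using \<delta> \<epsilon> by auto
  ultimately show ?thesis using that unfolding \<Phi>_def by blast
qed

section \<open>The power series solution\<close>

lemma leray_cmult: "leray (\<lambda>k n. s * F k n) k n = s * leray F k n"
proof -
  have "(\<Sum>m\<in>UNIV. of_int (k $ m) * (s * F k m)) = s * (\<Sum>m\<in>UNIV. of_int (k $ m) * F k m)"
    by (simp add: sum_distrib_left mult.left_commute)
  then show ?thesis by (simp add: leray_def algebra_simps)
qed

lemma leray_add: "leray (\<lambda>k n. F k n + G k n) k n = leray F k n + leray G k n"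
  by (simp add: leray_def algebra_simps sum.distrib add_divide_distrib)

lemma leray_sums:
  assumes "\<And>n. (\<lambda>m. F m k n) sums G k n"
  shows "(\<lambda>m. leray (F m) k n) sums leray G k n"
  unfolding leray_def
  by (cases "k = 0") (auto intro!: sums_diff assms sums_mult2 sums_divide sums_sum sums_mult)

lemma cmod_adv_s_le:
  assumes "(\<lambda>j. vabs u j * (kabs (k - j) * cmod (f (k - j)))) summable_on UNIV"
  shows "cmod (adv_s u f k) \<le> (\<Sum>\<^sub>\<infinity>j. vabs u j * (kabs (k - j) * cmod (f (k - j))))"
proof -
  let ?h = "\<lambda>j. \<i> * (\<Sum>m\<in>UNIV. u j m * of_int ((k-j)$m)) * f (k-j)"
  have le: "cmod (?h j) \<le> vabs u j * (kabs (k - j) * cmod (f (k - j)))" for j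
    using mult_right_mono[OF cmod_sum_times_component[of u j "k - j"], of "cmod (f (k - j))"]
    by (simp add: norm_mult mult_ac)
  have "(\<lambda>j. cmod (?h j)) summable_on UNIV"
    by (rule nonneg_summable_mono(1)[OF assms _ le]) auto
  then have "cmod (adv_s u f k) \<le> (\<Sum>\<^sub>\<infinity>j. cmod (?h j))"
    unfolding adv_s_def by (rule norm_infsum_bound)
  also have "\<dots> \<le> (\<Sum>\<^sub>\<infinity>j. vabs u j * (kabs (k - j) * cmod (f (k - j))))"
    by (rule nonneg_summable_mono(2)[OF assms _ le]) auto
  finally show ?thesis .
qed

lemma adv_v_eq_adv_s: "adv_v u v k n = adv_s u (\<lambda>k. v k n) k"
  by (simp add: adv_v_def adv_s_def)

lemma vabs_adv_v_le:
  assumes "(\<lambda>j. vabs u j * (kabs (k - j) * vabs v (k - j))) summable_on UNIV"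
  shows "vabs (adv_v u v) k \<le> (\<Sum>\<^sub>\<infinity>j. vabs u j * (kabs (k - j) * vabs v (k - j)))"
proof -
  have sums: "(\<lambda>j. vabs u j * (kabs (k - j) * cmod (v (k - j) n))) summable_on UNIV" for n
    by (rule nonneg_summable_mono(1)[OF assms]) (auto intro!: mult_left_mono cmod_le_vabs)
  have "vabs (adv_v u v) k \<le> (\<Sum>n\<in>UNIV. \<Sum>\<^sub>\<infinity>j. vabs u j * (kabs (k - j) * cmod (v (k - j) n)))"
    unfolding vabs_def[of "adv_v u v"] adv_v_eq_adv_s
    by (intro sum_mono cmod_adv_s_le sums)
  also have "\<dots> = (\<Sum>\<^sub>\<infinity>j. \<Sum>n\<in>UNIV. vabs u j * (kabs (k - j) * cmod (v (k - j) n)))"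
    by (rule infsumI[symmetric], rule has_sum_sum) (use sums in auto)
  finally show ?thesis
    by (simp add: vabs_def[of v] sum_distrib_left)
qed

text \<open>At wavevector 0 the symbol of each term is the scalar product of u(j) with -j, which
  vanishes by incompressibility: advection preserves the mean.\<close>

lemma adv_s_at_0:
  assumes "in_Hc u"
  shows "adv_s u f 0 = 0"
proof -
  have "(\<Sum>m\<in>UNIV. u j m * of_int ((0 - j) $ m)) = 0" for j
    using assms by (simp add: in_Hc_def sum_negf mult.commute)
  then show ?thesis by (simp add: adv_s_def)
qed

section \<open>The formal Taylor coefficients and their majorant\<close>

text \<open>The equations are compared at \<zeta>^n. The projection is applied outermost, so every
  velocity coefficient after the initial one is divergence free by construction.\<close>

fun boussinesq_coeff :: "real \<Rightarrow> 'd::finite \<Rightarrow> 'd vf \<Rightarrow> 'd sf \<Rightarrow> nat \<Rightarrow> 'd vf \<times> 'd sf" where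
  "boussinesq_coeff g e u0 \<eta>0 0 = (u0, \<eta>0)"
| "boussinesq_coeff g e u0 \<eta>0 (Suc n) =
    (leray (\<lambda>k l. inverse (of_nat (Suc n)) *
       (- (\<Sum>i\<le>n. adv_v (fst (boussinesq_coeff g e u0 \<eta>0 i)) (fst (boussinesq_coeff g e u0 \<eta>0 (n - i))) k l)
        + complex_of_real g * times_e e (snd (boussinesq_coeff g e u0 \<eta>0 n)) k l)),
     (\<lambda>k. inverse (of_nat (Suc n)) *
       - (\<Sum>i\<le>n. adv_s (fst (boussinesq_coeff g e u0 \<eta>0 i)) (snd (boussinesq_coeff g e u0 \<eta>0 (n - i))) k)))"

declare boussinesq_coeff.simps(2) [simp del]

text \<open>The two conditions in \<open>small\<close> are those of \<open>majorant_bound\<close>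
  with D = 1 + d and G = g / 8. The value \<mu> = 8 D produces this G: buoyancy contributes D g |c|,
  which is g / 8 times \<mu> |c|.\<close>

locale boussinesq_series =
  fixes g R \<beta> P \<mu> :: real and e :: "'d::finite" and u0 :: "'d vf" and \<eta>0 :: "'d sf"
  assumes pos: "g > 0" "R > 0" "\<beta> > 0" "P \<ge> 0"
    and u0: "in_Hc u0" and \<eta>0: "\<eta>0 0 = 0"
    and \<mu>: "\<mu> = 8 * (1 + real CARD('d))"
    and init: "(\<lambda>k. exp (\<beta> * kabs k) * (vabs u0 k + \<mu> * cmod (\<eta>0 k))) summable_on UNIV"
      "(\<Sum>\<^sub>\<infinity>k. exp (\<beta> * kabs k) * (vabs u0 k + \<mu> * cmod (\<eta>0 k))) \<le> P"
    and small: "(1 + real CARD('d)) * P * R \<le> \<beta> / 24" "g * R \<le> 2"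
begin

definition "a n = fst (boussinesq_coeff g e u0 \<eta>0 n)"
definition "c n = snd (boussinesq_coeff g e u0 \<eta>0 n)"
definition "p n k = vabs (a n) k + \<mu> * cmod (c n k)"

lemma \<mu>_ge_1: "\<mu> \<ge> 1"
  by (simp add: \<mu>)

lemma a_0: "a 0 = u0" and c_0: "c 0 = \<eta>0"
  by (simp_all add: a_def c_def)

lemma a_Suc: "a (Suc n) = leray (\<lambda>k l. inverse (of_nat (Suc n)) *
       (- (\<Sum>i\<le>n. adv_v (a i) (a (n - i)) k l) + complex_of_real g * times_e e (c n) k l))"
  by (simp add: a_def c_def boussinesq_coeff.simps)

lemma c_Suc: "c (Suc n) = (\<lambda>k. inverse (of_nat (Suc n)) * - (\<Sum>i\<le>n. adv_s (a i) (c (n - i)) k))"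
  by (simp add: a_def c_def boussinesq_coeff.simps)

lemma a_in_Hc: "in_Hc (a n)"
proof (cases n)
  case (Suc m)
  show ?thesis unfolding Suc a_Suc in_Hc_def
    by (simp add: leray_divergence_free) (simp add: leray_def)
qed (simp add: a_0 u0)

lemma c_at_0: "c n 0 = 0"
  by (cases n) (simp_all add: c_0 \<eta>0 c_Suc adv_s_at_0 a_in_Hc)

lemma p_nonneg [simp]: "0 \<le> p n k"
  using \<mu>_ge_1 by (simp add: p_def)

lemma vabs_a_le: "vabs (a n) k \<le> p n k"
  using \<mu>_ge_1 by (simp add: p_def)

lemma cmod_a_le: "cmod (a n k l) \<le> p n k"
  using cmod_le_vabs vabs_a_le order_trans by blast

lemma cmod_c_le: "cmod (c n k) \<le> p n k"
  using mult_right_mono[OF \<mu>_ge_1 norm_ge_zero[of "c n k"]] by (simp add: p_def add_increasing)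

text \<open>In both equations the advecting field is the velocity, so the two estimates combine to
  |a| |k - j| (|a| + \<mu> |c|), with the complete weighted quantity \<open>p\<close> in the
  transported slot. The advecting factor is then enlarged to \<open>p\<close>.\<close>

lemma p_recursion:
  assumes sums: "\<And>i. i \<le> n \<Longrightarrow> (\<lambda>j. p i j * (kabs (k - j) * p (n - i) (k - j))) summable_on UNIV"
  shows "real (Suc n) * p (Suc n) k
      \<le> (1 + real CARD('d)) * (\<Sum>i\<le>n. \<Sum>\<^sub>\<infinity>j. p i j * (kabs (k - j) * p (n - i) (k - j))) + g / 8 * p n k"
proof -
  define D where "D = 1 + real CARD('d)"
  have D: "D \<ge> 1" by (simp add: D_def)
  define V where "V i j = vabs (a i) j * (kabs (k - j) * vabs (a (n - i)) (k - j))" for i j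
  define S where "S i j = vabs (a i) j * (kabs (k - j) * cmod (c (n - i) (k - j)))" for i j
  have V: "V i summable_on UNIV" if "i \<le> n" for i
    unfolding V_def by (rule nonneg_summable_mono(1)[OF sums[OF that]])
      (auto intro!: mult_mono vabs_a_le)
  have S: "S i summable_on UNIV" if "i \<le> n" for i
    unfolding S_def by (rule nonneg_summable_mono(1)[OF sums[OF that]])
      (auto intro!: mult_mono vabs_a_le cmod_c_le)
  let ?X = "\<lambda>k l. - (\<Sum>i\<le>n. adv_v (a i) (a (n - i)) k l) + complex_of_real g * times_e e (c n) k l"
  have "vabs ?X k \<le> (\<Sum>l\<in>UNIV. (\<Sum>i\<le>n. cmod (adv_v (a i) (a (n - i)) k l)) + g * cmod (times_e e (c n) k l))"
    unfolding vabs_def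
  proof (rule sum_mono)
    fix l
    have "cmod (?X k l) \<le> cmod (\<Sum>i\<le>n. adv_v (a i) (a (n - i)) k l) + cmod (complex_of_real g * times_e e (c n) k l)"
      by (rule order_trans[OF norm_triangle_ineq]) simp
    also have "\<dots> \<le> (\<Sum>i\<le>n. cmod (adv_v (a i) (a (n - i)) k l)) + g * cmod (times_e e (c n) k l)"
      using pos by (intro add_mono norm_sum) (auto simp: norm_mult)
    finally show "cmod (?X k l) \<le> \<dots>" .
  qed
  also have "\<dots> = (\<Sum>i\<le>n. vabs (adv_v (a i) (a (n - i))) k) + g * vabs (times_e e (c n)) k"
    unfolding vabs_def sum.distrib sum_distrib_left by (subst sum.swap) simp
  also have "\<dots> \<le> (\<Sum>i\<le>n. infsum (V i) UNIV) + g * cmod (c n k)"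
    unfolding vabs_times_e unfolding V_def
    by (intro add_right_mono sum_mono vabs_adv_v_le) (use V in \<open>auto simp: V_def[abs_def]\<close>)
  finally have X: "vabs ?X k \<le> (\<Sum>i\<le>n. infsum (V i) UNIV) + g * cmod (c n k)" .
  have "real (Suc n) * vabs (a (Suc n)) k
      = vabs (leray ?X) k"
    unfolding a_Suc vabs_def leray_cmult
    by (simp add: norm_mult norm_inverse sum_distrib_left del: of_nat_Suc flip: mult.assoc)
  also have "\<dots> \<le> D * vabs ?X k"
    unfolding D_def by (rule leray_bound)
  also have "\<dots> \<le> D * ((\<Sum>i\<le>n. infsum (V i) UNIV) + g * cmod (c n k))"
    by (rule mult_left_mono[OF X]) (use D in simp)
  finally have A: "real (Suc n) * vabs (a (Suc n)) k \<le> D * ((\<Sum>i\<le>n. infsum (V i) UNIV) + g * cmod (c n k))" .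
  have "real (Suc n) * cmod (c (Suc n) k) = cmod (\<Sum>i\<le>n. adv_s (a i) (c (n - i)) k)"
    unfolding c_Suc by (simp add: norm_mult norm_inverse del: of_nat_Suc)
  also have "\<dots> \<le> (\<Sum>i\<le>n. infsum (S i) UNIV)"
    unfolding S_def by (intro sum_norm_le cmod_adv_s_le) (use S in \<open>auto simp: S_def[abs_def]\<close>)
  \<comment> \<open>The scalar equation has no projection; the factor \<open>D\<close> is inserted
    so that both equations carry the same constant.\<close>
  also have "\<dots> \<le> D * (\<Sum>i\<le>n. infsum (S i) UNIV)"
  proof -
    have "0 \<le> (\<Sum>i\<le>n. infsum (S i) UNIV)"
      by (intro sum_nonneg infsum_nonneg) (simp add: S_def)
    from mult_right_mono[OF D this] show ?thesis by simp
  qed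
  finally have B: "real (Suc n) * cmod (c (Suc n) k) \<le> D * (\<Sum>i\<le>n. infsum (S i) UNIV)" .
  have VS: "infsum (V i) UNIV + \<mu> * infsum (S i) UNIV
      \<le> (\<Sum>\<^sub>\<infinity>j. p i j * (kabs (k - j) * p (n - i) (k - j)))" if i: "i \<le> n" for i
  proof -
    have "((\<lambda>j. V i j + \<mu> * S i j) has_sum (infsum (V i) UNIV + \<mu> * infsum (S i) UNIV)) UNIV"
      using V[OF i] S[OF i] by (intro has_sum_add has_sum_cmult_right) auto
    moreover have "V i j + \<mu> * S i j \<le> p i j * (kabs (k - j) * p (n - i) (k - j))" for j
    proof -
      have "V i j + \<mu> * S i j = vabs (a i) j * (kabs (k - j) * p (n - i) (k - j))"
        by (simp add: V_def S_def p_def algebra_simps)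
      also have "\<dots> \<le> p i j * (kabs (k - j) * p (n - i) (k - j))"
        by (intro mult_right_mono vabs_a_le) auto
      finally show ?thesis .
    qed
    ultimately show ?thesis
      using sums[OF i] by (auto intro: has_sum_mono[OF _ has_sum_infsum])
  qed
  have "real (Suc n) * p (Suc n) k = real (Suc n) * vabs (a (Suc n)) k + \<mu> * (real (Suc n) * cmod (c (Suc n) k))"
    by (simp add: p_def algebra_simps)
  also have "\<dots> \<le> D * ((\<Sum>i\<le>n. infsum (V i) UNIV) + g * cmod (c n k)) + \<mu> * (D * (\<Sum>i\<le>n. infsum (S i) UNIV))"
    using \<mu>_ge_1 by (intro add_mono A mult_left_mono B) auto
  also have "\<dots> = D * (\<Sum>i\<le>n. infsum (V i) UNIV + \<mu> * infsum (S i) UNIV) + g / 8 * (\<mu> * cmod (c n k))"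
    by (simp add: sum.distrib sum_distrib_left algebra_simps \<mu> D_def)
  also have "\<dots> \<le> D * (\<Sum>i\<le>n. \<Sum>\<^sub>\<infinity>j. p i j * (kabs (k - j) * p (n - i) (k - j))) + g / 8 * p n k"
    using D pos by (intro add_mono mult_left_mono sum_mono VS) (auto simp: p_def)
  finally show ?thesis by (simp add: D_def)
qed

lemma p_weighted_bound:
  assumes "0 \<le> b" "b < 1"
  shows "(\<lambda>k. exp (b * \<beta> * kabs k) * p n k) summable_on UNIV"
    and "(\<Sum>\<^sub>\<infinity>k. exp (b * \<beta> * kabs k) * p n k) \<le> P * majorant n / (R * (1 - b)) ^ n"
proof -
  have p0: "p 0 k = vabs u0 k + \<mu> * cmod (\<eta>0 k)" for k by (simp add: p_def a_0 c_0)
  have "g / 8 * R = g * R / 8" by simp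
  with small(2) have "g / 8 * R \<le> 1 / 4" by linarith
  then have "(\<lambda>k. exp (b * \<beta> * kabs k) * p n k) summable_on UNIV \<and>
    (\<Sum>\<^sub>\<infinity>k. exp (b * \<beta> * kabs k) * p n k) \<le> P * majorant n / (R * (1 - b)) ^ n"
    using p_recursion pos small init assms
    by (intro majorant_bound[where D = "1 + real CARD('d)" and G = "g / 8"]) (auto simp: p0)
  then show "(\<lambda>k. exp (b * \<beta> * kabs k) * p n k) summable_on UNIV"
    "(\<Sum>\<^sub>\<infinity>k. exp (b * \<beta> * kabs k) * p n k) \<le> P * majorant n / (R * (1 - b)) ^ n" by auto
qed

section \<open>Convergence of the series and passage to the equations\<close>

text \<open>A common majorant for mode k of both unknowns on the disc of radius \<rho>; it serves as
  the dominating sequence for holomorphy and for all exchanges of summation.\<close>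

definition "q \<rho> k = (\<Sum>m. p m k * \<rho> ^ m)"

lemma
  assumes \<rho>: "0 \<le> \<rho>" "\<rho> < R"
  shows p_power_summable: "summable (\<lambda>m. p m k * \<rho> ^ m)"
    and q_exp_summable: "\<exists>s>0. (\<lambda>k. exp (s * kabs k) * q \<rho> k) summable_on UNIV"
proof -
  \<comment> \<open>This makes R (1 - b) the midpoint of \<rho> and R. The powers of \<rho> are
    thereby absorbed, the majorant sequence alone gives convergence in \<open>m\<close>, and the
    weight exp (b \<beta> |k|) with b > 0 remains.\<close>
  define b where "b = (1 - \<rho> / R) / 2"
  have b: "0 < b" "b < 1" "\<rho> \<le> R * (1 - b)" using \<rho> pos by (auto simp: b_def field_simps)
  have fin: "(\<Sum>k\<in>F. exp (b * \<beta> * kabs k) * (p m k * \<rho> ^ m)) \<le> P * majorant m" if "finite F" for F m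
  proof -
    have "(\<Sum>k\<in>F. exp (b * \<beta> * kabs k) * (p m k * \<rho> ^ m)) = (\<Sum>k\<in>F. exp (b * \<beta> * kabs k) * p m k) * \<rho> ^ m"
      by (simp add: sum_distrib_right mult.assoc)
    also have "\<dots> \<le> (\<Sum>\<^sub>\<infinity>k. exp (b * \<beta> * kabs k) * p m k) * \<rho> ^ m"
      using b \<rho> that by (intro mult_right_mono finite_sum_le_infsum p_weighted_bound) auto
    also have "\<dots> \<le> (P * majorant m / (R * (1 - b)) ^ m) * (R * (1 - b)) ^ m"
      using b \<rho> pos by (intro mult_mono p_weighted_bound power_mono) auto
    also have "\<dots> = P * majorant m" using b pos by simp
    finally show ?thesis .
  qed
  have le: "p m k * \<rho> ^ m \<le> P * majorant m" for m k
  proof -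
    have "1 * (p m k * \<rho> ^ m) \<le> exp (b * \<beta> * kabs k) * (p m k * \<rho> ^ m)"
      using b pos \<rho> by (intro mult_right_mono) auto
    then show ?thesis using fin[of "{k}" m] by simp
  qed
  have sumM: "summable (\<lambda>m. P * majorant m)"
    by (intro summable_mult majorant_summable)
  show sum: "summable (\<lambda>m. p m k * \<rho> ^ m)" for k
    by (rule summable_comparison_test'[OF sumM]) (use le \<rho> in auto)
  have "(\<lambda>k. exp (b * \<beta> * kabs k) * q \<rho> k) summable_on UNIV"
  proof (rule nonneg_summable_boundI(1))
    show "0 \<le> exp (b * \<beta> * kabs k) * q \<rho> k" for k
      unfolding q_def by (intro mult_nonneg_nonneg suminf_nonneg sum) (use \<rho> in auto)
    fix F :: "(int^'d) set" assume F: "finite F"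
    have "(\<Sum>k\<in>F. exp (b * \<beta> * kabs k) * q \<rho> k) = (\<Sum>m. \<Sum>k\<in>F. exp (b * \<beta> * kabs k) * (p m k * \<rho> ^ m))"
      unfolding q_def using sum
      by (subst suminf_sum) (auto simp: suminf_mult intro: summable_mult)
    also have "\<dots> \<le> (\<Sum>m. P * majorant m)"
      using sum fin[OF F] sumM by (intro suminf_le) (auto intro!: summable_sum summable_mult)
    finally show "(\<Sum>k\<in>F. exp (b * \<beta> * kabs k) * q \<rho> k) \<le> (\<Sum>m. P * majorant m)" .
  qed
  then show "\<exists>s>0. (\<lambda>k. exp (s * kabs k) * q \<rho> k) summable_on UNIV"
    using b pos by (intro exI[of _ "b * \<beta>"]) auto
qed

lemma q_nonneg: "0 \<le> \<rho> \<Longrightarrow> \<rho> < R \<Longrightarrow> 0 \<le> q \<rho> k"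
  unfolding q_def by (intro suminf_nonneg p_power_summable) auto

text \<open>The remaining exponential weight pays for the single derivative, after which both
  factors are summable and the convolution converges.\<close>

lemma q_convolution_summable:
  assumes \<rho>: "0 \<le> \<rho>" "\<rho> < R"
  shows "(\<lambda>j. q \<rho> j * (kabs (k - j) * q \<rho> (k - j))) summable_on UNIV"
proof -
  obtain s where s: "s > 0" "(\<lambda>k. exp (s * kabs k) * q \<rho> k) summable_on UNIV"
    using q_exp_summable[OF \<rho>] by blast
  have q0: "0 \<le> q \<rho> k" for k using q_nonneg[OF \<rho>] .
  have 1: "q \<rho> summable_on UNIV"
  proof (rule nonneg_summable_mono(1)[OF s(2) q0])
    show "q \<rho> k \<le> exp (s * kabs k) * q \<rho> k" for k
      using mult_right_mono[OF _ q0, of 1 "exp (s * kabs k)" k] s by simp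
  qed
  have "(\<lambda>k. inverse s * (exp (s * kabs k) * q \<rho> k)) summable_on UNIV"
    using s by (intro summable_on_cmult_right)
  then have 2: "(\<lambda>k. kabs k * q \<rho> k) summable_on UNIV"
  proof (rule nonneg_summable_mono(1))
    fix k :: "int^'d"
    have "s * kabs k \<le> exp (s * kabs k)" using exp_ge_add_one_self[of "s * kabs k"] by linarith
    then have "kabs k \<le> inverse s * exp (s * kabs k)" using s by (simp add: field_simps)
    from mult_right_mono[OF this q0]
    show "kabs k * q \<rho> k \<le> inverse s * (exp (s * kabs k) * q \<rho> k)" by (simp add: mult.assoc)
  qed (auto simp: q0)
  show ?thesis
    by (rule convolution_summable(1)) (use 1 2 q0 in auto)
qed

lemma
  assumes f: "\<And>m. cmod (f m) \<le> p m k" and z: "cmod z < R"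
  shows series_norm_summable: "summable (\<lambda>m. cmod (f m * z ^ m))"
    and series_norm_le: "cmod (\<Sum>m. f m * z ^ m) \<le> q (cmod z) k"
    and series_deriv: "((\<lambda>z. \<Sum>m. f m * z ^ m) has_field_derivative
      (\<Sum>m. of_nat (Suc m) * f (Suc m) * z ^ m)) (at z)"
proof -
  have summ: "summable (\<lambda>m. cmod (f m * z ^ m))" if "cmod z < R" for z
    by (rule summable_comparison_test'[OF p_power_summable[of "cmod z" k]])
      (use that f in \<open>auto simp: norm_mult norm_power intro!: mult_right_mono\<close>)
  then show "summable (\<lambda>m. cmod (f m * z ^ m))" using z .
  show "cmod (\<Sum>m. f m * z ^ m) \<le> q (cmod z) k"
    unfolding q_def
    by (rule norm_suminf_le[OF _ p_power_summable])
      (use z f in \<open>auto simp: norm_mult norm_power intro!: mult_right_mono\<close>)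
  obtain \<rho> where \<rho>: "cmod z < \<rho>" "\<rho> < R" using dense[OF z] by blast
  have \<rho>0: "\<rho> > 0" using \<rho>(1) norm_ge_zero[of z] by linarith
  have 1: "summable (\<lambda>m. f m * complex_of_real \<rho> ^ m)"
    using summ[of "complex_of_real \<rho>"] \<rho> \<rho>0 by (auto intro: summable_norm_cancel)
  have "((\<lambda>z. \<Sum>m. f m * z ^ m) has_field_derivative (\<Sum>m. diffs f m * z ^ m)) (at z)"
    using 1 by (rule termdiffs_strong) (use \<rho> \<rho>0 in auto)
  then show "((\<lambda>z. \<Sum>m. f m * z ^ m) has_field_derivative
      (\<Sum>m. of_nat (Suc m) * f (Suc m) * z ^ m)) (at z)" by (simp add: diffs_def)
qed

lemma q_mono:
  assumes "0 \<le> \<rho>" "\<rho> \<le> \<rho>'" "\<rho>' < R"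
  shows "q \<rho> k \<le> q \<rho>' k"
  unfolding q_def using assms
  by (intro suminf_le p_power_summable mult_left_mono power_mono) auto

definition "U z k l = (\<Sum>m. a m k l * z ^ m)"
definition "E z k = (\<Sum>m. c m k * z ^ m)"

lemma hol_sf_series:
  assumes r: "r > 0" and f: "\<And>m k. cmod (f m k) \<le> p m k"
  shows "hol_sf r (ball 0 R) (\<lambda>z k. \<Sum>m. f m k * z ^ m)"
proof (rule hol_sf_if_dominated)
  show "(\<lambda>z. \<Sum>m. f m k * z ^ m) holomorphic_on ball 0 R" for k
  proof -
    have "\<exists>D. ((\<lambda>z. \<Sum>m. f m k * z ^ m) has_field_derivative D) (at z)" if "z \<in> ball 0 R" for z
      using series_deriv[of "\<lambda>m. f m k" k z, OF f] that by (intro exI) simp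
    then show ?thesis by (simp add: holomorphic_on_open field_differentiable_def)
  qed
  fix \<rho> assume \<rho>: "0 < \<rho>" "\<rho> < R"
  obtain s where s: "s > 0" "(\<lambda>k. exp (s * kabs k) * q \<rho> k) summable_on UNIV"
    using q_exp_summable[of \<rho>] \<rho> by auto
  have "(\<lambda>k. gweight r 0 k * (q \<rho> k)\<^sup>2) summable_on UNIV"
    by (rule gweight_square_summable[OF s(1) r _ s(2)]) (use \<rho> in \<open>auto intro: q_nonneg\<close>)
  moreover have "cmod (\<Sum>m. f m k * z ^ m) \<le> q \<rho> k" if "z \<in> ball 0 \<rho>" for z k
  proof -
    have "cmod (\<Sum>m. f m k * z ^ m) \<le> q (cmod z) k"
      by (rule series_norm_le[OF f]) (use \<rho> that in auto)
    also have "\<dots> \<le> q \<rho> k" by (rule q_mono) (use \<rho> that in auto)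
    finally show ?thesis .
  qed
  ultimately show "\<exists>q. (\<forall>z\<in>ball 0 \<rho>. \<forall>k. cmod (\<Sum>m. f m k * z ^ m) \<le> q k) \<and>
      (\<lambda>k. gweight r 0 k * (q k)\<^sup>2) summable_on UNIV" by blast
qed

text \<open>The array \<open>w j m\<close> is the z^m part of the j-th convolution term. Summing
  over \<open>m\<close> first gives the nonlinearity of the summed series, summing over
  \<open>j\<close> first gives the coefficients of the recursion; Fubini needs absolute summability
  of the array.\<close>

lemma adv_s_series:
  assumes f: "\<And>m k. cmod (f m k) \<le> p m k" and z: "cmod z < R"
  shows "(\<lambda>m. (\<Sum>i\<le>m. adv_s (a i) (f (m - i)) k) * z ^ m) sums adv_s (U z) (\<lambda>k. \<Sum>m. f m k * z ^ m) k"
proof -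
  define \<rho> where "\<rho> = cmod z"
  have \<rho>: "0 \<le> \<rho>" "\<rho> < R" using z by (auto simp: \<rho>_def)
  define A where "A j i = \<i> * (\<Sum>l\<in>UNIV. a i j l * of_int ((k-j)$l)) * z ^ i" for j i
  define B where "B j i = f i (k - j) * z ^ i" for j i
  define w where "w j m = (\<Sum>i\<le>m. A j i * B j (m - i))" for j m
  define p1 where "p1 j i = (p i j * kabs (k - j)) * \<rho> ^ i" for j i
  define p2 where "p2 j i = p i (k - j) * \<rho> ^ i" for j i
  have A_le: "cmod (A j i) \<le> p1 j i" for j i
  proof -
    have "cmod (A j i) = cmod (\<Sum>l\<in>UNIV. a i j l * of_int ((k-j)$l)) * \<rho> ^ i"
      by (simp add: A_def norm_mult norm_power \<rho>_def)
    also have "\<dots> \<le> (vabs (a i) j * kabs (k - j)) * \<rho> ^ i"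
      using \<rho> by (intro mult_right_mono cmod_sum_times_component) auto
    also have "\<dots> \<le> p1 j i"
      unfolding p1_def using \<rho> by (intro mult_right_mono vabs_a_le) auto
    finally show ?thesis .
  qed
  have B_le: "cmod (B j i) \<le> p2 j i" for j i
    using f \<rho> by (auto simp: B_def p2_def norm_mult norm_power \<rho>_def intro!: mult_right_mono)
  have p1_sums: "p1 j sums (q \<rho> j * kabs (k - j))" for j
    using sums_mult2[OF summable_sums[OF p_power_summable[OF \<rho>, of j]], of "kabs (k - j)"]
    by (simp add: p1_def[abs_def] q_def mult_ac)
  have p2_sums: "p2 j sums q \<rho> (k - j)" for j
    using summable_sums[OF p_power_summable[OF \<rho>, of "k - j"]] by (simp add: p2_def[abs_def] q_def)
  have pnn: "0 \<le> p1 j i" "0 \<le> p2 j i" for j i using \<rho> by (auto simp: p1_def p2_def)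
  have A_summ: "summable (\<lambda>i. cmod (A j i))" for j
    by (rule summable_comparison_test'[OF sums_summable[OF p1_sums]]) (use A_le in auto)
  have B_summ: "summable (\<lambda>i. cmod (B j i))" for j
    by (rule summable_comparison_test'[OF sums_summable[OF p2_sums]]) (use B_le in auto)
  have "summable (\<lambda>m. a m j l * z ^ m)" for j l
    by (rule summable_norm_cancel, rule series_norm_summable[OF cmod_a_le z])
  then have "(\<lambda>i. \<i> * (\<Sum>l\<in>UNIV. (a i j l * z ^ i) * of_int ((k-j)$l))) sums
      (\<i> * (\<Sum>l\<in>UNIV. U z j l * of_int ((k-j)$l)))" for j
    unfolding U_def by (intro sums_mult sums_sum sums_mult2 summable_sums)
  then have A_suminf: "(\<Sum>i. A j i) = \<i> * (\<Sum>l\<in>UNIV. U z j l * of_int ((k-j)$l))" for j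
    by (intro sums_unique[symmetric]) (simp add: A_def[abs_def] sum_distrib_left sum_distrib_right mult_ac)
  have w_sums: "w j sums (\<i> * (\<Sum>l\<in>UNIV. U z j l * of_int ((k-j)$l)) * (\<Sum>m. f m (k-j) * z ^ m))" for j
    using Cauchy_product_sums[OF A_summ B_summ, of j j] unfolding A_suminf
    by (simp add: w_def[abs_def] B_def)
  \<comment> \<open>The Cauchy product of the majorant series dominates the array. Its row sums are
    the terms q(j) |k - j| q(k - j), already known to be summable in \<open>j\<close>.\<close>
  define W where "W j m = (\<Sum>i\<le>m. p1 j i * p2 j (m - i))" for j m
  have w_le: "cmod (w j m) \<le> W j m" for j m
    unfolding w_def W_def
    by (rule sum_norm_le) (auto simp: norm_mult intro!: mult_mono A_le B_le pnn)
  have W_sums: "W j sums (q \<rho> j * (kabs (k - j) * q \<rho> (k - j)))" for j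
    using Cauchy_product_sums[of "p1 j" "p2 j"] p1_sums[of j] p2_sums[of j] pnn
    by (simp add: W_def[abs_def] sums_iff mult.assoc)
  have W_nn: "0 \<le> W j m" for j m by (auto simp: W_def intro!: sum_nonneg mult_nonneg_nonneg pnn)
  have "(\<lambda>(j, m). W j m) summable_on UNIV \<times> UNIV"
  proof (rule summable_on_SigmaI)
    show "((\<lambda>m. case (j, m) of (j, m) \<Rightarrow> W j m) has_sum (q \<rho> j * (kabs (k - j) * q \<rho> (k - j)))) UNIV" for j
      using sums_nonneg_imp_has_sum[OF W_sums W_nn] by simp
    show "(\<lambda>j. q \<rho> j * (kabs (k - j) * q \<rho> (k - j))) summable_on UNIV"
      by (rule q_convolution_summable[OF \<rho>])
  qed (use W_nn in auto)
  then have "(\<lambda>x. norm (case x of (j, m) \<Rightarrow> w j m)) summable_on UNIV \<times> UNIV"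
    by (rule summable_on_comparison_test) (auto simp: w_le)
  then have w_summ: "(\<lambda>(j, m). w j m) summable_on UNIV \<times> UNIV"
    by (rule abs_summable_summable)
  have w_j: "(\<Sum>\<^sub>\<infinity>j. w j m) = (\<Sum>i\<le>m. adv_s (a i) (f (m - i)) k) * z ^ m" for m
  proof -
    have "(\<Sum>\<^sub>\<infinity>j. w j m) = (\<Sum>i\<le>m. \<Sum>\<^sub>\<infinity>j. A j i * B j (m - i))"
      unfolding w_def
    proof (rule infsumI, rule has_sum_sum, rule has_sum_infsum)
      fix i assume i: "i \<in> {..m}"
      have "(\<lambda>j. norm (A j i * B j (m - i))) summable_on UNIV"
      proof (rule nonneg_summable_mono(1)[OF q_convolution_summable[OF \<rho>, of k]])
        fix j
        have "norm (A j i * B j (m - i)) \<le> p1 j i * p2 j (m - i)"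
          unfolding norm_mult by (intro mult_mono A_le B_le pnn) auto
        also have "\<dots> \<le> (q \<rho> j * kabs (k - j)) * q \<rho> (k - j)"
        proof (rule mult_mono)
          show "p1 j i \<le> q \<rho> j * kabs (k - j)"
            using sum_le_suminf[OF sums_summable[OF p1_sums[of j]], of "{i}"] pnn p1_sums[of j]
            by (simp add: sums_iff)
          show "p2 j (m - i) \<le> q \<rho> (k - j)"
            using sum_le_suminf[OF sums_summable[OF p2_sums[of j]], of "{m - i}"] pnn p2_sums[of j]
            by (simp add: sums_iff)
        qed (use pnn q_nonneg[OF \<rho>] in auto)
        finally show "norm (A j i * B j (m - i)) \<le> q \<rho> j * (kabs (k - j) * q \<rho> (k - j))"
          by (simp add: mult.assoc)
      qed auto
      then show "(\<lambda>j. A j i * B j (m - i)) summable_on UNIV" by (rule abs_summable_summable)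
    qed
    also have "\<dots> = (\<Sum>i\<le>m. adv_s (a i) (f (m - i)) k * z ^ m)"
    proof (rule sum.cong[OF refl])
      fix i assume i: "i \<in> {..m}"
      then have "z ^ m = z ^ i * z ^ (m - i)" by (simp flip: power_add)
      then have "A j i * B j (m - i) =
          (\<i> * (\<Sum>l\<in>UNIV. a i j l * of_int ((k-j)$l)) * f (m - i) (k - j)) * z ^ m" for j
        by (simp add: A_def B_def mult_ac)
      then show "(\<Sum>\<^sub>\<infinity>j. A j i * B j (m - i)) = adv_s (a i) (f (m - i)) k * z ^ m"
        by (simp add: adv_s_def infsum_cmult_left')
    qed
    finally show ?thesis by (simp add: sum_distrib_right)
  qed
  have "(\<lambda>(m, j). w j m) summable_on UNIV \<times> UNIV"
    using w_summ summable_on_swap[of "\<lambda>(j, m). w j m" UNIV UNIV] by (simp add: case_prod_unfold)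
  then have "(\<lambda>m. \<Sum>\<^sub>\<infinity>j. w j m) summable_on UNIV"
    using summable_on_Sigma_banach[of "\<lambda>m j. w j m" UNIV "\<lambda>_. UNIV"] by simp
  then have "(\<lambda>m. \<Sum>\<^sub>\<infinity>j. w j m) sums (\<Sum>\<^sub>\<infinity>m. \<Sum>\<^sub>\<infinity>j. w j m)"
    by (intro has_sum_imp_sums has_sum_infsum)
  also have "(\<Sum>\<^sub>\<infinity>m. \<Sum>\<^sub>\<infinity>j. w j m) = (\<Sum>\<^sub>\<infinity>j. \<Sum>\<^sub>\<infinity>m. w j m)"
    using infsum_swap_banach[OF w_summ] by simp
  also have "\<dots> = adv_s (U z) (\<lambda>k. \<Sum>m. f m k * z ^ m) k"
    unfolding adv_s_def
  proof (rule infsum_cong)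
    fix j
    have "(\<lambda>m. norm (w j m)) summable_on UNIV"
    proof (rule nonneg_summable_mono(1))
      show "W j summable_on UNIV"
        using sums_nonneg_imp_has_sum[OF W_sums W_nn] by (rule has_sum_imp_summable)
    qed (use w_le in auto)
    then have "w j summable_on UNIV" by (rule abs_summable_summable)
    then have "w j sums (\<Sum>\<^sub>\<infinity>m. w j m)" by (intro has_sum_imp_sums has_sum_infsum)
    then show "(\<Sum>\<^sub>\<infinity>m. w j m) =
        \<i> * (\<Sum>l\<in>UNIV. U z j l * of_int ((k-j)$l)) * (\<Sum>m. f m (k-j) * z ^ m)"
      using w_sums sums_unique2 by blast
  qed
  finally show ?thesis unfolding w_j .
qed

lemma U_in_Hc: "cmod z < R \<Longrightarrow> in_Hc (U z)"
  unfolding in_Hc_def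
proof (intro conjI allI)
  assume z: "cmod z < R"
  show "U z 0 n = 0" for n
    using a_in_Hc by (simp add: U_def in_Hc_def)
  fix k
  have "summable (\<lambda>m. a m k l * z ^ m)" for l
    by (rule summable_norm_cancel, rule series_norm_summable[OF cmod_a_le z])
  then have "(\<lambda>i. \<Sum>l\<in>UNIV. of_int (k$l) * (a i k l * z ^ i)) sums (\<Sum>l\<in>UNIV. of_int (k$l) * U z k l)"
    unfolding U_def by (intro sums_sum sums_mult summable_sums)
  moreover have "(\<Sum>l\<in>UNIV. of_int (k$l) * (a i k l * z ^ i)) = (\<Sum>l\<in>UNIV. of_int (k$l) * a i k l) * z ^ i" for i
    by (simp add: sum_distrib_right mult.assoc)
  ultimately have "(\<lambda>i. 0) sums (\<Sum>l\<in>UNIV. of_int (k$l) * U z k l)"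
    using a_in_Hc by (simp add: in_Hc_def)
  then show "(\<Sum>l\<in>UNIV. of_int (k$l) * U z k l) = 0"
    using sums_unique2 sums_zero by blast
qed

text \<open>At a fixed wavevector the projection is a linear map between finitely many components,
  so it commutes with summation over \<open>m\<close>; the recursion then identifies the result with
  the termwise derivative.\<close>

lemma U_deriv:
  assumes z: "cmod z < R"
  shows "((\<lambda>z. U z k l) has_field_derivative
    (- Bop (U z) (U z) k l + complex_of_real g * leray (times_e e (E z)) k l)) (at z)"
proof -
  define X where "X m k l = - ((\<Sum>i\<le>m. adv_v (a i) (a (m - i)) k l) * z ^ m)
      + complex_of_real g * (times_e e (c m) k l * z ^ m)" for m k l
  have "(\<lambda>m. leray (X m) k l) sums
      leray (\<lambda>k l. - adv_v (U z) (U z) k l + complex_of_real g * times_e e (E z) k l) k l"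
  proof (rule leray_sums)
    fix n
    have 1: "(\<lambda>m. (\<Sum>i\<le>m. adv_v (a i) (a (m - i)) k n) * z ^ m) sums adv_v (U z) (U z) k n"
      using adv_s_series[of "\<lambda>m k. a m k n" z k] cmod_a_le z
      by (simp add: adv_v_eq_adv_s U_def[abs_def])
    have 2: "(\<lambda>m. times_e e (c m) k n * z ^ m) sums times_e e (E z) k n"
      using summable_sums[OF summable_norm_cancel[OF series_norm_summable[OF cmod_c_le z]]]
      by (auto simp: times_e_def E_def)
    show "(\<lambda>m. X m k n) sums (- adv_v (U z) (U z) k n + complex_of_real g * times_e e (E z) k n)"
      unfolding X_def by (intro sums_add sums_minus sums_mult 1 2)
  qed
  moreover have "leray (X m) k l = of_nat (Suc m) * a (Suc m) k l * z ^ m" for m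
  proof -
    have X: "X m = (\<lambda>k l. z ^ m * (- (\<Sum>i\<le>m. adv_v (a i) (a (m - i)) k l) + complex_of_real g * times_e e (c m) k l))"
      by (simp add: X_def fun_eq_iff algebra_simps)
    show ?thesis unfolding X a_Suc leray_cmult by (simp del: of_nat_Suc)
  qed
  ultimately have "(\<lambda>m. of_nat (Suc m) * a (Suc m) k l * z ^ m) sums
      leray (\<lambda>k l. - adv_v (U z) (U z) k l + complex_of_real g * times_e e (E z) k l) k l"
    by simp
  moreover have "leray (\<lambda>k l. - adv_v (U z) (U z) k l + complex_of_real g * times_e e (E z) k l) k l
      = - Bop (U z) (U z) k l + complex_of_real g * leray (times_e e (E z)) k l"
    unfolding leray_add Bop_def
    using leray_cmult[of "-1" "adv_v (U z) (U z)"] leray_cmult[of "complex_of_real g" "times_e e (E z)"]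
    by simp
  ultimately show ?thesis
    using series_deriv[of "\<lambda>m. a m k l" k z, OF cmod_a_le z] unfolding U_def by (simp add: sums_iff)
qed

lemma E_deriv:
  assumes z: "cmod z < R"
  shows "((\<lambda>z. E z k) has_field_derivative (- adv_s (U z) (E z) k)) (at z)"
proof -
  have "(\<lambda>m. - ((\<Sum>i\<le>m. adv_s (a i) (c (m - i)) k) * z ^ m)) sums - adv_s (U z) (E z) k"
    using sums_minus[OF adv_s_series[of c z k, OF cmod_c_le z]] by (simp add: E_def[abs_def])
  moreover have "of_nat (Suc m) * c (Suc m) k * z ^ m = - ((\<Sum>i\<le>m. adv_s (a i) (c (m - i)) k) * z ^ m)" for m
    unfolding c_Suc by (simp del: of_nat_Suc)
  ultimately show ?thesis
    using series_deriv[of "\<lambda>m. c m k" k z, OF cmod_c_le z] unfolding E_def by (simp add: sums_iff)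
qed

lemma bouss_sol_series:
  assumes "r > 0"
  shows "bouss_sol r g e (ball 0 R) u0 \<eta>0 U E"
  unfolding bouss_sol_def
proof (intro conjI ballI allI)
  show "U 0 = u0" "E 0 = \<eta>0"
    by (simp_all add: fun_eq_iff U_def E_def a_0 c_0)
  show "hol_vf r (ball 0 R) U"
    unfolding hol_vf_iff_components[OF open_ball] U_def
    using hol_sf_series[OF assms] cmod_a_le by simp
  show "hol_sf r (ball 0 R) E"
    unfolding E_def using hol_sf_series[OF assms] cmod_c_le by simp
  fix \<zeta> assume "\<zeta> \<in> ball (0 :: complex) R"
  then have \<zeta>: "cmod \<zeta> < R" by simp
  show "in_Hc (U \<zeta>)" by (rule U_in_Hc[OF \<zeta>])
  show "E \<zeta> 0 = 0" by (simp add: E_def c_at_0)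
  show "((\<lambda>z. U z k n) has_field_derivative
      (- Bop (U \<zeta>) (U \<zeta>) k n + complex_of_real g * leray (times_e e (E \<zeta>)) k n)) (at \<zeta>)" for k n
    by (rule U_deriv[OF \<zeta>])
  show "((\<lambda>z. E z k) has_field_derivative (- adv_s (U \<zeta>) (E \<zeta>) k)) (at \<zeta>)" for k
    by (rule E_deriv[OF \<zeta>])
qed (use pos in auto)

end

section \<open>Uniqueness\<close>

text \<open>Each term is split by x y \<le> x^2 + y^2 into a square of the velocity and a square of
  the gradient of \<open>f\<close>, both dominated by the weight because r \<ge> 1. Summing over the
  d components gives 2 d K, the same for every \<open>J\<close> and \<open>k\<close>.\<close>

lemma
  fixes u :: "'d::finite vf" and f :: "'d sf"
  assumes r: "1 \<le> r" and u: "in_Hc u" "\<And>m. sf_gev r 0 (\<lambda>k. u k m)" and f: "sf_gev r 0 f"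
    and K: "\<And>m. (\<Sum>\<^sub>\<infinity>k. gweight r 0 k * (cmod (u k m))\<^sup>2) \<le> K"
      "(\<Sum>\<^sub>\<infinity>k. gweight r 0 k * (cmod (f k))\<^sup>2) \<le> K"
  defines "T \<equiv> \<lambda>k j. \<i> * (\<Sum>m\<in>UNIV. u j m * of_int ((k-j)$m)) * f (k-j)"
  shows adv_s_has_sum: "(T k has_sum adv_s u f k) UNIV"
    and adv_s_partial_sum_le: "finite J \<Longrightarrow> cmod (sum (T k) J) \<le> 2 * real CARD('d) * K"
proof -
  define G where "G j = (\<Sum>m\<in>(UNIV :: 'd set). gweight r 0 j * (cmod (u j m))\<^sup>2
      + gweight r 0 (k - j) * (cmod (f (k - j)))\<^sup>2)" for j
  have bij: "bij_betw (\<lambda>j. k - j) UNIV (UNIV :: (int^'d) set)"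
    by (rule bij_betwI[where g = "\<lambda>j. k - j"]) auto
  have "((\<lambda>j. gweight r 0 (k - j) * (cmod (f (k - j)))\<^sup>2) has_sum
      (\<Sum>\<^sub>\<infinity>k. gweight r 0 k * (cmod (f k))\<^sup>2)) UNIV"
    using has_sum_reindex_bij_betw[OF bij, of "\<lambda>k. gweight r 0 k * (cmod (f k))\<^sup>2"] f
    by (simp add: sf_gev_def)
  then have G: "(G has_sum (\<Sum>m\<in>(UNIV :: 'd set). (\<Sum>\<^sub>\<infinity>k. gweight r 0 k * (cmod (u k m))\<^sup>2)
      + (\<Sum>\<^sub>\<infinity>k. gweight r 0 k * (cmod (f k))\<^sup>2))) UNIV"
    unfolding G_def using u(2) by (intro has_sum_sum has_sum_add) (auto simp: sf_gev_def)
  have le: "cmod (T k j) \<le> G j" for j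
  proof -
    have "cmod (T k j) = cmod (\<Sum>m\<in>UNIV. u j m * of_int ((k-j)$m)) * cmod (f (k - j))"
      by (simp add: T_def norm_mult)
    also have "\<dots> \<le> (vabs u j * kabs (k - j)) * cmod (f (k - j))"
      by (intro mult_right_mono cmod_sum_times_component) auto
    also have "\<dots> = (\<Sum>m\<in>UNIV. cmod (u j m) * (kabs (k - j) * cmod (f (k - j))))"
      by (simp add: vabs_def sum_distrib_right mult.assoc)
    also have "\<dots> \<le> G j"
      unfolding G_def
    proof (rule sum_mono)
      fix m
      let ?x = "cmod (u j m)" and ?y = "kabs (k - j) * cmod (f (k - j))"
      have "?x * ?y \<le> ?x\<^sup>2 + ?y\<^sup>2"
      proof -
        have "2 * (?x * ?y) \<le> ?x\<^sup>2 + ?y\<^sup>2" using sum_squares_bound[of ?x ?y] by (simp only: mult.assoc)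
        moreover have "0 \<le> ?x * ?y" by simp
        ultimately show ?thesis by linarith
      qed
      \<comment> \<open>The weight is 0 at j = 0, where the mean-zero condition takes over;
        elsewhere it is at least 1.\<close>
      also have "?x\<^sup>2 \<le> gweight r 0 j * (cmod (u j m))\<^sup>2"
      proof (cases "j = 0")
        case False
        then show ?thesis
          using mult_right_mono[OF one_le_gweight[of r j], of "?x\<^sup>2"] r by simp
      qed (use u(1) in \<open>simp add: in_Hc_def\<close>)
      also have "?y\<^sup>2 \<le> gweight r 0 (k - j) * (cmod (f (k - j)))\<^sup>2"
        unfolding power_mult_distrib by (intro mult_right_mono kabs_power2_le_gweight r) auto
      finally show "?x * ?y \<le> gweight r 0 j * (cmod (u j m))\<^sup>2 + gweight r 0 (k - j) * (cmod (f (k - j)))\<^sup>2"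
        by simp
    qed
    finally show ?thesis .
  qed
  have G0: "0 \<le> G j" for j using le[of j] norm_ge_zero[of "T k j"] by linarith
  have "(\<lambda>j. norm (T k j)) summable_on UNIV"
    by (rule nonneg_summable_mono(1)[OF has_sum_imp_summable[OF G] _ le]) auto
  then have "T k summable_on UNIV" by (rule abs_summable_summable)
  then show "(T k has_sum adv_s u f k) UNIV"
    unfolding adv_s_def T_def by (rule has_sum_infsum)
  assume J: "finite J"
  have "cmod (sum (T k) J) \<le> sum G J" by (intro sum_norm_le le)
  also have "\<dots> \<le> infsum G UNIV"
    by (rule finite_sum_le_infsum[OF has_sum_imp_summable[OF G] J]) (use G0 in auto)
  also have "\<dots> = (\<Sum>m\<in>(UNIV :: 'd set). (\<Sum>\<^sub>\<infinity>k. gweight r 0 k * (cmod (u k m))\<^sup>2)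
      + (\<Sum>\<^sub>\<infinity>k. gweight r 0 k * (cmod (f k))\<^sup>2))"
    using G by (rule infsumI)
  also have "\<dots> \<le> (\<Sum>m\<in>(UNIV :: 'd set). K + K)"
    by (intro sum_mono add_mono K)
  finally show "cmod (sum (T k) J) \<le> 2 * real CARD('d) * K" by simp
qed

definition gev_bounded_family :: "real \<Rightarrow> real \<Rightarrow> real \<Rightarrow> (complex \<Rightarrow> 'd::finite sf) \<Rightarrow> bool" where
  "gev_bounded_family r \<rho> K f \<longleftrightarrow> (\<forall>k. (\<lambda>z. f z k) holomorphic_on ball 0 \<rho>) \<and>
     (\<forall>z\<in>ball 0 \<rho>. sf_gev r 0 (f z) \<and> (\<Sum>\<^sub>\<infinity>k. gweight r 0 k * (cmod (f z k))\<^sup>2) \<le> K)"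

text \<open>The orders of vanishing of the modes enter one finite set \<open>J\<close> at a time and
  yield a bound whose constant involves the common supremum \<open>M\<close>, \<rho> and
  \<open>n\<close> but not \<open>J\<close>, so it survives the limit over \<open>J\<close>.\<close>

lemma adv_s_diff_bigo:
  fixes u u' :: "complex \<Rightarrow> 'd::finite vf" and f f' :: "complex \<Rightarrow> 'd sf"
  assumes r: "1 \<le> r" and \<rho>: "\<rho> > 0"
    and Hc: "\<And>z. z \<in> ball 0 \<rho> \<Longrightarrow> in_Hc (u z)" "\<And>z. z \<in> ball 0 \<rho> \<Longrightarrow> in_Hc (u' z)"
    and fam: "\<And>m. gev_bounded_family r \<rho> K (\<lambda>z k. u z k m)" "\<And>m. gev_bounded_family r \<rho> K (\<lambda>z k. u' z k m)"
      "gev_bounded_family r \<rho> K f" "gev_bounded_family r \<rho> K f'"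
    and bigo: "\<And>k m. (\<lambda>z. u z k m - u' z k m) \<in> O[at 0](\<lambda>z. z ^ n)"
      "\<And>k. (\<lambda>z. f z k - f' z k) \<in> O[at 0](\<lambda>z. z ^ n)"
  shows "(\<lambda>z. adv_s (u z) (f z) k - adv_s (u' z) (f' z) k) \<in> O[at 0](\<lambda>z. z ^ n)"
proof -
  define T where "T u f j = \<i> * (\<Sum>m\<in>UNIV. u j m * of_int ((k-j)$m)) * f (k-j)"
    for u :: "'d vf" and f :: "'d sf" and j
  define F where "F J z = (\<Sum>j\<in>J. T (u z) (f z) j - T (u' z) (f' z) j)" for J z
  define M where "M = 4 * real CARD('d) * K"
  have hol: "(\<lambda>z. u z j m) holomorphic_on ball 0 \<rho>" "(\<lambda>z. u' z j m) holomorphic_on ball 0 \<rho>"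
    "(\<lambda>z. f z j) holomorphic_on ball 0 \<rho>" "(\<lambda>z. f' z j) holomorphic_on ball 0 \<rho>" for j m
    using fam by (auto simp: gev_bounded_family_def)
  have O1: "(\<lambda>z. h z) \<in> O[at 0](\<lambda>_. 1)" if "h holomorphic_on ball 0 \<rho>" for h :: "complex \<Rightarrow> complex"
  proof (rule bigoI_tendsto)
    have "isCont h 0"
      using holomorphic_on_imp_continuous_on[OF that] \<rho> by (simp add: continuous_on_eq_continuous_at)
    then show "((\<lambda>z. h z / 1) \<longlongrightarrow> h 0) (at 0)" by (simp add: isCont_def)
  qed auto
  have F_bound: "cmod (F J z) \<le> 2 * M * (2 / \<rho>) ^ n * cmod z ^ n"
    if J: "finite J" and z: "cmod z \<le> \<rho> / 4" for J z
  proof (rule vanishing_holomorphic_bound[OF _ \<rho> _ _ z])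
    show "F J holomorphic_on ball 0 \<rho>"
      unfolding F_def T_def by (intro holomorphic_intros hol)
    show "cmod (F J z) \<le> M" if z: "z \<in> ball 0 \<rho>" for z
    proof -
      have "F J z = sum (T (u z) (f z)) J - sum (T (u' z) (f' z)) J"
        by (simp add: F_def sum_subtractf)
      also have "cmod \<dots> \<le> cmod (sum (T (u z) (f z)) J) + cmod (sum (T (u' z) (f' z)) J)"
        by (rule norm_triangle_ineq4)
      also have "\<dots> \<le> 2 * real CARD('d) * K + 2 * real CARD('d) * K"
        unfolding T_def using fam z J
        by (intro add_mono adv_s_partial_sum_le[OF r] Hc) (auto simp: gev_bounded_family_def)
      finally show ?thesis by (simp add: M_def mult_ac)
    qed
    have "(\<lambda>z. T (u z) (f z) j - T (u' z) (f' z) j) \<in> O[at 0](\<lambda>z. z ^ n)" for j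
    proof -
      have "(\<lambda>z. (u z j m - u' z j m) * f z (k-j)) \<in> O[at 0](\<lambda>z. z ^ n)" for m
        using landau_o.big.mult[OF bigo(1)[of j m] O1[OF hol(3)[of "k - j"]]] by simp
      moreover have "(\<lambda>z. (f z (k-j) - f' z (k-j)) * u' z j m) \<in> O[at 0](\<lambda>z. z ^ n)" for m
        using landau_o.big.mult[OF bigo(2)[of "k - j"] O1[OF hol(2)[of j m]]] by simp
      \<comment> \<open>The splitting u f - u' f' = (u - u') f + (f - f') u': in each product one
        factor is O(z^n) and the other is bounded near 0.\<close>
      ultimately have "(\<lambda>z. \<Sum>m\<in>UNIV. (\<i> * of_int ((k-j)$m)) * ((u z j m - u' z j m) * f z (k-j)
          + (f z (k-j) - f' z (k-j)) * u' z j m)) \<in> O[at 0](\<lambda>z. z ^ n)"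
        by (intro big_sum_in_bigo) (simp add: sum_in_bigo)
      moreover have "(\<Sum>m\<in>UNIV. (\<i> * of_int ((k-j)$m)) * ((u z j m - u' z j m) * f z (k-j)
          + (f z (k-j) - f' z (k-j)) * u' z j m)) = T (u z) (f z) j - T (u' z) (f' z) j" for z
        unfolding T_def sum_distrib_left sum_distrib_right sum_subtractf[symmetric]
        by (intro sum.cong refl) (simp add: algebra_simps)
      ultimately show ?thesis by simp
    qed
    then show "F J \<in> O[at 0](\<lambda>z. z ^ n)"
      unfolding F_def by (intro big_sum_in_bigo)
  qed
  have "cmod (adv_s (u z) (f z) k - adv_s (u' z) (f' z) k) \<le> 2 * M * (2 / \<rho>) ^ n * cmod z ^ n"
    if z: "cmod z \<le> \<rho> / 4" for z
  proof -
    have zb: "z \<in> ball 0 \<rho>" using z \<rho> by auto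
    have 1: "(T (u z) (f z) has_sum adv_s (u z) (f z) k) UNIV"
      unfolding T_def using fam zb Hc by (intro adv_s_has_sum[OF r, where K = K]) (auto simp: gev_bounded_family_def)
    have 2: "(T (u' z) (f' z) has_sum adv_s (u' z) (f' z) k) UNIV"
      unfolding T_def using fam zb Hc by (intro adv_s_has_sum[OF r, where K = K]) (auto simp: gev_bounded_family_def)
    have "((\<lambda>J. cmod (F J z)) \<longlongrightarrow> cmod (adv_s (u z) (f z) k - adv_s (u' z) (f' z) k)) (finite_subsets_at_top UNIV)"
      using 1 2 unfolding has_sum_def F_def sum_subtractf by (intro tendsto_norm tendsto_diff) auto
    then show ?thesis
    proof (rule tendsto_upperbound)
      show "eventually (\<lambda>J. cmod (F J z) \<le> 2 * M * (2 / \<rho>) ^ n * cmod z ^ n) (finite_subsets_at_top UNIV)"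
        by (rule eventually_finite_subsets_at_top_weakI) (use F_bound z in auto)
    qed simp
  qed
  then have "eventually (\<lambda>z. cmod (adv_s (u z) (f z) k - adv_s (u' z) (f' z) k)
      \<le> (2 * M * (2 / \<rho>) ^ n) * cmod (z ^ n)) (at 0)"
    unfolding eventually_at using \<rho> by (intro exI[of _ "\<rho> / 4"]) (auto simp: norm_power)
  then show ?thesis by (rule bigoI)
qed

lemma leray_diff_bigo:
  fixes F F' :: "complex \<Rightarrow> 'd::finite vf"
  assumes "\<And>l. (\<lambda>z. F z k l - F' z k l) \<in> O[at 0](\<lambda>z. z ^ n)"
  shows "(\<lambda>z. leray (F z) k l - leray (F' z) k l) \<in> O[at 0](\<lambda>z. z ^ n)"
proof -
  have "(\<lambda>z. leray (\<lambda>k n. F z k n - F' z k n) k l) \<in> O[at 0](\<lambda>z. z ^ n)"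
  proof (cases "k = 0")
    case False
    have c: "(\<lambda>z. c * h z) \<in> O[at 0](\<lambda>z. z ^ n)" if "h \<in> O[at 0](\<lambda>z. z ^ n)"
      for c and h :: "complex \<Rightarrow> complex"
      using that by (cases "c = 0") auto
    have "(\<lambda>z. (F z k l - F' z k l) - (of_int (k$l) / complex_of_real (ksq k)) *
        (\<Sum>m\<in>UNIV. of_int (k$m) * (F z k m - F' z k m))) \<in> O[at 0](\<lambda>z. z ^ n)"
      by (intro sum_in_bigo(2)[OF assms] c big_sum_in_bigo assms)
    then show ?thesis using False by (simp add: leray_def mult.commute)
  qed (simp add: leray_def)
  then show ?thesis by (simp add: leray_diff)
qed

lemma bouss_sol_unique:
  fixes U U' :: "complex \<Rightarrow> 'd::finite vf"
  assumes r: "1 \<le> r" and sol: "bouss_sol r g e (ball 0 R) u0 \<eta>0 U E" "bouss_sol r g e (ball 0 R) u0 \<eta>0 U' E'"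
    and \<zeta>: "\<zeta> \<in> ball 0 R"
  shows "U \<zeta> = U' \<zeta> \<and> E \<zeta> = E' \<zeta>"
proof -
  have R: "R > 0" using sol(1) by (simp add: bouss_sol_def)
  note S = open_ball[of "0::complex" R]
  \<comment> \<open>Stated for all small radii so that the finitely many components of both
    solutions can afterwards share one radius.\<close>
  have fam: "\<exists>K. eventually (\<lambda>\<rho>. gev_bounded_family r \<rho> K f) (at_right 0)"
    if hol: "hol_sf r (ball 0 R) f" "\<And>k. (\<lambda>z. f z k) holomorphic_on ball 0 R" for f :: "complex \<Rightarrow> 'd sf"
  proof -
    obtain \<rho> K where \<rho>: "\<rho> > 0" "ball 0 \<rho> \<subseteq> ball (0 :: complex) R"
      "\<And>z. z \<in> ball 0 \<rho> \<Longrightarrow> (\<Sum>\<^sub>\<infinity>k. gweight r 0 k * (cmod (f z k))\<^sup>2) \<le> K"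
      using hol_sf_locally_bounded[OF S _ hol(1)] R by auto
    have "gev_bounded_family r \<rho>' K f" if "\<rho>' < \<rho>" for \<rho>'
      unfolding gev_bounded_family_def
    proof (intro conjI ballI allI)
      have sub: "ball 0 \<rho>' \<subseteq> ball (0 :: complex) \<rho>" using that by auto
      show "(\<lambda>z. f z k) holomorphic_on ball 0 \<rho>'" for k
        by (rule holomorphic_on_subset[OF hol(2)]) (use sub \<rho> in blast)
      fix z :: complex assume "z \<in> ball 0 \<rho>'"
      then have "z \<in> ball 0 \<rho>" using sub by blast
      then show "sf_gev r 0 (f z)" "(\<Sum>\<^sub>\<infinity>k. gweight r 0 k * (cmod (f z k))\<^sup>2) \<le> K"
        using \<rho> hol(1) by (auto simp: hol_sf_def)
    qed
    then have "eventually (\<lambda>\<rho>. gev_bounded_family r \<rho> K f) (at_right 0)"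
      unfolding eventually_at_right_field using \<rho>(1) by blast
    then show ?thesis by blast
  qed
  have fam_mono: "gev_bounded_family r \<rho> K' f" if "gev_bounded_family r \<rho> K f" "K \<le> K'" for \<rho> K K' and f :: "complex \<Rightarrow> 'd sf"
    using that by (auto simp: gev_bounded_family_def intro: order_trans)
  have dU: "\<And>z k l. z \<in> ball 0 R \<Longrightarrow> ((\<lambda>z. U z k l) has_field_derivative
      (- Bop (U z) (U z) k l + complex_of_real g * leray (times_e e (E z)) k l)) (at z)"
    and dE: "\<And>z k. z \<in> ball 0 R \<Longrightarrow> ((\<lambda>z. E z k) has_field_derivative (- adv_s (U z) (E z) k)) (at z)"
    and dU': "\<And>z k l. z \<in> ball 0 R \<Longrightarrow> ((\<lambda>z. U' z k l) has_field_derivative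
      (- Bop (U' z) (U' z) k l + complex_of_real g * leray (times_e e (E' z)) k l)) (at z)"
    and dE': "\<And>z k. z \<in> ball 0 R \<Longrightarrow> ((\<lambda>z. E' z k) has_field_derivative (- adv_s (U' z) (E' z) k)) (at z)"
    using sol unfolding bouss_sol_def by blast+
  have hol: "(\<lambda>z. U z k l) holomorphic_on ball 0 R" "(\<lambda>z. E z k) holomorphic_on ball 0 R"
    "(\<lambda>z. U' z k l) holomorphic_on ball 0 R" "(\<lambda>z. E' z k) holomorphic_on ball 0 R" for k l
    using dU dE dU' dE' unfolding holomorphic_on_open[OF open_ball] by blast+
  have Hc: "\<And>z. z \<in> ball 0 R \<Longrightarrow> in_Hc (U z)" "\<And>z. z \<in> ball 0 R \<Longrightarrow> in_Hc (U' z)"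
    using sol unfolding bouss_sol_def by blast+
  have holU: "hol_sf r (ball 0 R) (\<lambda>z k. U z k l)" "hol_sf r (ball 0 R) (\<lambda>z k. U' z k l)" for l
    using sol hol_vf_iff_components[OF S] unfolding bouss_sol_def by blast+
  have "\<forall>l. \<exists>K. eventually (\<lambda>\<rho>. gev_bounded_family r \<rho> K (\<lambda>z k. U z k l)) (at_right 0)"
    using fam[OF holU(1) hol(1)] by blast
  from choice[OF this] obtain KU where KU: "\<And>l. eventually (\<lambda>\<rho>. gev_bounded_family r \<rho> (KU l) (\<lambda>z k. U z k l)) (at_right 0)"
    by blast
  have "\<forall>l. \<exists>K. eventually (\<lambda>\<rho>. gev_bounded_family r \<rho> K (\<lambda>z k. U' z k l)) (at_right 0)"
    using fam[OF holU(2) hol(3)] by blast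
  from choice[OF this] obtain KU' where KU': "\<And>l. eventually (\<lambda>\<rho>. gev_bounded_family r \<rho> (KU' l) (\<lambda>z k. U' z k l)) (at_right 0)"
    by blast
  obtain KE where KE: "eventually (\<lambda>\<rho>. gev_bounded_family r \<rho> KE E) (at_right 0)"
    using fam[of E] hol sol by (auto simp: bouss_sol_def)
  obtain KE' where KE': "eventually (\<lambda>\<rho>. gev_bounded_family r \<rho> KE' E') (at_right 0)"
    using fam[of E'] hol sol by (auto simp: bouss_sol_def)
  define K where "K = \<bar>KE\<bar> + \<bar>KE'\<bar> + (\<Sum>l\<in>UNIV. \<bar>KU l\<bar> + \<bar>KU' l\<bar>)"
  have "\<bar>KU l\<bar> + \<bar>KU' l\<bar> \<le> (\<Sum>l\<in>UNIV. \<bar>KU l\<bar> + \<bar>KU' l\<bar>)" for l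
    by (rule member_le_sum) auto
  then have Ks: "KU l \<le> K" "KU' l \<le> K" for l
    unfolding K_def by (smt (verit))+
  have Ks': "KE \<le> K" "KE' \<le> K"
    using sum_nonneg[of UNIV "\<lambda>l. \<bar>KU l\<bar> + \<bar>KU' l\<bar>"] by (auto simp: K_def)
  have "eventually (\<lambda>\<rho>. (\<forall>l. gev_bounded_family r \<rho> (KU l) (\<lambda>z k. U z k l)) \<and>
      (\<forall>l. gev_bounded_family r \<rho> (KU' l) (\<lambda>z k. U' z k l)) \<and>
      gev_bounded_family r \<rho> KE E \<and> gev_bounded_family r \<rho> KE' E' \<and> 0 < \<rho> \<and> \<rho> < R) (at_right 0)"
    using KU KU' KE KE' R
    by (intro eventually_conj eventually_all_finite eventually_at_right_less)
      (auto simp: eventually_at_right_field)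
  from eventually_happens'[OF trivial_limit_at_right_real this]
  obtain \<rho> where \<rho>: "\<And>l. gev_bounded_family r \<rho> (KU l) (\<lambda>z k. U z k l)"
      "\<And>l. gev_bounded_family r \<rho> (KU' l) (\<lambda>z k. U' z k l)"
      "gev_bounded_family r \<rho> KE E" "gev_bounded_family r \<rho> KE' E'" "0 < \<rho>" "\<rho> < R"
    by blast
  note fams = fam_mono[OF \<rho>(1) Ks(1)] fam_mono[OF \<rho>(2) Ks(2)] fam_mono[OF \<rho>(3) Ks'(1)] fam_mono[OF \<rho>(4) Ks'(2)]
  have Hc': "\<And>z. z \<in> ball 0 \<rho> \<Longrightarrow> in_Hc (U z)" "\<And>z. z \<in> ball 0 \<rho> \<Longrightarrow> in_Hc (U' z)"
    using Hc \<rho> by auto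
  have vanish: "(\<forall>k l. (\<lambda>z. U z k l - U' z k l) \<in> O[at 0](\<lambda>z. z ^ n)) \<and>
      (\<forall>k. (\<lambda>z. E z k - E' z k) \<in> O[at 0](\<lambda>z. z ^ n))" for n
  proof (induction n)
    case 0
    have O1: "h \<in> O[at 0](\<lambda>z. z ^ 0)" if "h holomorphic_on ball 0 R" for h :: "complex \<Rightarrow> complex"
    proof (rule bigoI_tendsto)
      have "isCont h 0"
        using holomorphic_on_imp_continuous_on[OF that] R by (simp add: continuous_on_eq_continuous_at)
      then show "((\<lambda>z. h z / z ^ 0) \<longlongrightarrow> h 0) (at 0)" by (simp add: isCont_def)
    qed auto
    show ?case by (intro conjI allI O1 holomorphic_on_diff hol)
  next
    case (Suc n)
    then have IH: "\<And>k l. (\<lambda>z. U z k l - U' z k l) \<in> O[at 0](\<lambda>z. z ^ n)"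
      "\<And>k. (\<lambda>z. E z k - E' z k) \<in> O[at 0](\<lambda>z. z ^ n)" by auto
    have advE: "(\<lambda>z. adv_s (U z) (E z) k - adv_s (U' z) (E' z) k) \<in> O[at 0](\<lambda>z. z ^ n)" for k
      by (rule adv_s_diff_bigo[OF r \<rho>(5) Hc' fams IH])
    have "(\<lambda>z. adv_s (U z) (\<lambda>k. U z k l) k - adv_s (U' z) (\<lambda>k. U' z k l) k) \<in> O[at 0](\<lambda>z. z ^ n)" for k l
      by (rule adv_s_diff_bigo[OF r \<rho>(5) Hc' fams(1,2,1,2) IH(1,1)])
    then have advU: "(\<lambda>z. adv_v (U z) (U z) k l - adv_v (U' z) (U' z) k l) \<in> O[at 0](\<lambda>z. z ^ n)" for k l
      by (simp add: adv_v_def adv_s_def)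
    have "(\<lambda>z. times_e e (E z) k l - times_e e (E' z) k l) \<in> O[at 0](\<lambda>z. z ^ n)" for k l
      using IH(2) by (cases "l = e") (auto simp: times_e_def)
    then have te: "(\<lambda>z. leray (times_e e (E z)) k l - leray (times_e e (E' z)) k l) \<in> O[at 0](\<lambda>z. z ^ n)" for k l
      by (rule leray_diff_bigo)
    have B: "(\<lambda>z. Bop (U z) (U z) k l - Bop (U' z) (U' z) k l) \<in> O[at 0](\<lambda>z. z ^ n)" for k l
      unfolding Bop_def by (rule leray_diff_bigo) (rule advU)
    have 0: "U 0 = U' 0" "E 0 = E' 0" using sol by (auto simp: bouss_sol_def)
    show ?case
    proof (intro conjI allI)
      fix k
      show "(\<lambda>z. E z k - E' z k) \<in> O[at 0](\<lambda>z. z ^ Suc n)"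
      proof (rule bigo_power_Suc_if_deriv[OF _ R])
        show "((\<lambda>z. E z k - E' z k) has_field_derivative
            - adv_s (U z) (E z) k - - adv_s (U' z) (E' z) k) (at z)" if "z \<in> ball 0 R" for z
          using that by (intro DERIV_diff dE dE')
        show "(\<lambda>z. - adv_s (U z) (E z) k - - adv_s (U' z) (E' z) k) \<in> O[at 0](\<lambda>z. z ^ n)"
          using landau_o.big.uminus_in_iff[of "\<lambda>z. adv_s (U z) (E z) k - adv_s (U' z) (E' z) k"] advE[of k]
          by simp
      qed (simp add: 0)
      fix l
      show "(\<lambda>z. U z k l - U' z k l) \<in> O[at 0](\<lambda>z. z ^ Suc n)"
      proof (rule bigo_power_Suc_if_deriv[OF _ R])
        show "((\<lambda>z. U z k l - U' z k l) has_field_derivative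
            (- Bop (U z) (U z) k l + complex_of_real g * leray (times_e e (E z)) k l)
            - (- Bop (U' z) (U' z) k l + complex_of_real g * leray (times_e e (E' z)) k l)) (at z)"
          if "z \<in> ball 0 R" for z
          using that by (intro DERIV_diff dU dU')
        have "(\<lambda>z. complex_of_real g * (leray (times_e e (E z)) k l - leray (times_e e (E' z)) k l)
            - (Bop (U z) (U z) k l - Bop (U' z) (U' z) k l)) \<in> O[at 0](\<lambda>z. z ^ n)"
          using te[of k l] by (cases "g = 0"; intro sum_in_bigo(2)[OF _ B]) auto
        then show "(\<lambda>z. (- Bop (U z) (U z) k l + complex_of_real g * leray (times_e e (E z)) k l)
            - (- Bop (U' z) (U' z) k l + complex_of_real g * leray (times_e e (E' z)) k l)) \<in> O[at 0](\<lambda>z. z ^ n)"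
          by (simp add: algebra_simps)
      qed (simp add: 0)
    qed
  qed
  \<comment> \<open>The uniform bounds live on a small disc, but vanishing to all orders at 0
    concerns Taylor coefficients, so it propagates to the whole ball of radius
    \<open>R\<close>.\<close>
  have zero: "h \<zeta> = 0" if "h holomorphic_on ball 0 R" "\<And>n. h \<in> O[at 0](\<lambda>z. z ^ n)" for h
    using that \<zeta> higher_deriv_eq_0_if_bigo[OF that(1) R that(2) lessI]
    by (intro holomorphic_fun_eq_0_on_ball[OF that(1)]) auto
  have "(\<lambda>z. U z k l - U' z k l) \<zeta> = 0" "(\<lambda>z. E z k - E' z k) \<zeta> = 0" for k l
    by (rule zero; (intro holomorphic_on_diff hol | use vanish in blast))+
  then show ?thesis by (simp add: fun_eq_iff)
qed

section \<open>The initial data and the radius\<close>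

text \<open>Cauchy-Schwarz with f = |k|^(-(d+1)/2) and h = |k|^r exp (\<beta> |k|) Y. Off the origin
  |k| \<ge> 1 and r > (d + 1) / 2, so f h dominates the Wiener summand; at the origin the data
  vanish.\<close>

lemma gevrey_data_l1_bound:
  fixes u0 :: "'d::finite vf" and \<eta>0 :: "'d sf"
  assumes r: "r > (real CARD('d) + 1) / 2"
    and u0: "in_Hc u0" "vf_gev r \<beta> u0" and \<eta>0: "\<eta>0 0 = 0" "sf_gev r \<beta> \<eta>0" and \<mu>: "\<mu> \<ge> 0"
  shows "(\<lambda>k. exp (\<beta> * kabs k) * (vabs u0 k + \<mu> * cmod (\<eta>0 k))) summable_on UNIV" (is ?sum)
    and "(\<Sum>\<^sub>\<infinity>k. exp (\<beta> * kabs k) * (vabs u0 k + \<mu> * cmod (\<eta>0 k)))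
      \<le> sqrt (infsum lattice_weight (UNIV :: (int^'d) set)) * sqrt (2 * (real CARD('d) + \<mu>\<^sup>2))
        * sqrt (vf_gnorm2 r \<beta> u0 + sf_gnorm2 r \<beta> \<eta>0)" (is ?le)
proof -
  define Y where "Y k = vabs u0 k + \<mu> * cmod (\<eta>0 k)" for k
  define f where "f k = (if k = 0 then 0 else kabs k powr (- (real CARD('d) + 1) / 2))" for k :: "int^'d"
  define h where "h k = kabs k powr r * exp (\<beta> * kabs k) * Y k" for k
  define V where "V k = gweight r \<beta> k * (\<Sum>n\<in>UNIV. (cmod (u0 k n))\<^sup>2)" for k
  define S where "S k = gweight r \<beta> k * (cmod (\<eta>0 k))\<^sup>2" for k
  \<comment> \<open>The 2 comes from squaring the sum of the velocity and scalar parts, the d from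
    comparing the l^1 and l^2 norms over components.\<close>
  define M where "M = 2 * (real CARD('d) + \<mu>\<^sup>2)"
  have Y0: "0 \<le> Y k" for k using \<mu> by (simp add: Y_def)
  have V: "V summable_on UNIV" using u0(2) unfolding vf_gev_def V_def .
  have S: "S summable_on UNIV" using \<eta>0(2) unfolding sf_gev_def S_def .
  have f2: "(\<lambda>k. (f k)\<^sup>2) = lattice_weight"
    by (auto simp: f_def lattice_weight_def power2_eq_square fun_eq_iff simp flip: powr_add)
  have h2: "(h k)\<^sup>2 \<le> M * (V k + S k)" for k
  proof -
    have "(vabs u0 k)\<^sup>2 \<le> real CARD('d) * (\<Sum>n\<in>UNIV. (cmod (u0 k n))\<^sup>2)"
      using Cauchy_Schwarz_ineq_sum[of "\<lambda>_. 1" "\<lambda>n. cmod (u0 k n)" UNIV] by (simp add: vabs_def)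
    moreover have "(Y k)\<^sup>2 \<le> 2 * ((vabs u0 k)\<^sup>2 + (\<mu> * cmod (\<eta>0 k))\<^sup>2)"
      unfolding Y_def using zero_le_power2[of "vabs u0 k - \<mu> * cmod (\<eta>0 k)"]
      by (simp add: power2_eq_square algebra_simps)
    ultimately have "(Y k)\<^sup>2 \<le> 2 * (real CARD('d) * (\<Sum>n\<in>UNIV. (cmod (u0 k n))\<^sup>2) + \<mu>\<^sup>2 * (cmod (\<eta>0 k))\<^sup>2)"
      by (simp add: power_mult_distrib)
    also have "\<dots> \<le> M * ((\<Sum>n\<in>UNIV. (cmod (u0 k n))\<^sup>2) + (cmod (\<eta>0 k))\<^sup>2)"
      unfolding M_def by (simp add: algebra_simps sum_nonneg)
    finally have "gweight r \<beta> k * (Y k)\<^sup>2 \<le> gweight r \<beta> k * (M * ((\<Sum>n\<in>UNIV. (cmod (u0 k n))\<^sup>2) + (cmod (\<eta>0 k))\<^sup>2))"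
      by (intro mult_left_mono) auto
    moreover have "(h k)\<^sup>2 = gweight r \<beta> k * (Y k)\<^sup>2"
    proof -
      have "gweight r \<beta> k = (kabs k powr r * exp (\<beta> * kabs k))\<^sup>2"
        by (simp add: gweight_def power2_eq_square mult_ac flip: powr_add exp_add)
      then show ?thesis by (simp add: h_def power_mult_distrib)
    qed
    ultimately show ?thesis by (simp add: V_def S_def algebra_simps)
  qed
  have MVS: "((\<lambda>k. M * (V k + S k)) has_sum (M * (infsum V UNIV + infsum S UNIV))) UNIV"
    using V S by (intro has_sum_cmult_right has_sum_add) auto
  have h_summ: "(\<lambda>k. (h k)\<^sup>2) summable_on UNIV"
    by (rule nonneg_summable_mono(1)[OF has_sum_imp_summable[OF MVS] _ h2]) simp
  have VS0: "0 \<le> infsum V UNIV" "0 \<le> infsum S UNIV"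
    by (auto intro!: infsum_nonneg simp: V_def S_def sum_nonneg)
  have "(\<Sum>\<^sub>\<infinity>k. (h k)\<^sup>2) \<le> (\<Sum>\<^sub>\<infinity>k. M * (V k + S k))"
    by (rule nonneg_summable_mono(2)[OF has_sum_imp_summable[OF MVS] _ h2]) simp
  also have "\<dots> = M * (infsum V UNIV + infsum S UNIV)"
    using MVS by (rule infsumI)
  also have "\<dots> \<le> M * ((2 * pi) ^ CARD('d) * (infsum V UNIV + infsum S UNIV))"
  proof (rule mult_left_mono)
    have "1 \<le> (2 * pi) ^ CARD('d)" using pi_gt3 by (intro one_le_power) auto
    from mult_right_mono[OF this, of "infsum V UNIV + infsum S UNIV"]
    show "infsum V UNIV + infsum S UNIV \<le> (2 * pi) ^ CARD('d) * (infsum V UNIV + infsum S UNIV)"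
      using VS0 by simp
  qed (simp add: M_def)
  also have "\<dots> = M * (vf_gnorm2 r \<beta> u0 + sf_gnorm2 r \<beta> \<eta>0)"
    unfolding vf_gnorm2_def sf_gnorm2_def V_def S_def by (simp add: distrib_left)
  finally have h_le: "(\<Sum>\<^sub>\<infinity>k. (h k)\<^sup>2) \<le> M * (vf_gnorm2 r \<beta> u0 + sf_gnorm2 r \<beta> \<eta>0)" .
  have f_summ: "(\<lambda>k. (f k)\<^sup>2) summable_on UNIV"
    unfolding f2 by (rule lattice_weight_summable)
  have f0: "0 \<le> f k" and h0: "0 \<le> h k" for k using Y0 by (auto simp: f_def h_def)
  have fh: "exp (\<beta> * kabs k) * Y k \<le> f k * h k" for k
  proof (cases "k = 0")
    case True
    then show ?thesis using u0(1) \<eta>0(1) by (simp add: Y_def vabs_def in_Hc_def f_def)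
  next
    case False
    have "1 \<le> kabs k powr (- (real CARD('d) + 1) / 2 + r)"
      using kabs_ge_1[OF False] r by (intro ge_one_powr_ge_zero) (auto simp: field_simps)
    then have "1 \<le> f k * kabs k powr r" using False by (simp add: f_def powr_add)
    from mult_right_mono[OF this, of "exp (\<beta> * kabs k) * Y k"] show ?thesis
      using Y0 by (simp add: h_def mult_ac)
  qed
  note CS = infsum_Cauchy_Schwarz[OF f_summ h_summ f0 h0]
  have nn: "0 \<le> exp (\<beta> * kabs k) * Y k" for k using Y0 by simp
  show ?sum
    using nonneg_summable_mono(1)[OF CS(1) nn fh] by (simp add: Y_def)
  have "(\<Sum>\<^sub>\<infinity>k. exp (\<beta> * kabs k) * Y k) \<le> (\<Sum>\<^sub>\<infinity>k. f k * h k)"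
    by (rule nonneg_summable_mono(2)[OF CS(1) nn fh])
  also have "\<dots> \<le> sqrt (\<Sum>\<^sub>\<infinity>k. (f k)\<^sup>2) * sqrt (\<Sum>\<^sub>\<infinity>k. (h k)\<^sup>2)"
    by (rule CS(2))
  also have "\<dots> \<le> sqrt (\<Sum>\<^sub>\<infinity>k. (f k)\<^sup>2) * sqrt (M * (vf_gnorm2 r \<beta> u0 + sf_gnorm2 r \<beta> \<eta>0))"
    by (intro mult_left_mono real_sqrt_le_mono h_le real_sqrt_ge_zero infsum_nonneg) auto
  finally show ?le
    unfolding f2 by (simp add: Y_def M_def real_sqrt_mult mult.assoc)
qed

text \<open>The quotient in \<open>C_W\<close> is at least 1: its denominator is positive and
  smaller than its numerator by 1.\<close>

lemma C_W_lower_bound: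
  assumes "r > (real d + 1) / 2"
  shows "1 / (pi * 2 ^ (d - 1)) \<le> C_W d r"
proof -
  have "1 \<le> (2 * r - real d) / (2 * r - 1 - real d)"
    using assms by (simp add: field_simps)
  from mult_left_mono[OF this, of "1 / (pi * 2 ^ (d - 1))"] show ?thesis
    by (simp add: C_W_def)
qed

theorem theorem5p1:
  assumes "CARD('d::finite) \<in> {2, 3}"
  shows "\<exists>C>0. \<forall>(r::real) (\<beta>0::real) (g::real) (e::'d) (u0::'d vf) (\<eta>0::'d sf).
     r > (real CARD('d) + 1) / 2 \<and> \<beta>0 > 0 \<and> g > 0 \<and>
     in_Hc u0 \<and> real_vf u0 \<and> real_sf \<eta>0 \<and> \<eta>0 0 = 0 \<and>
     vf_gev r \<beta>0 u0 \<and> sf_gev r \<beta>0 \<eta>0 \<longrightarrow>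
     (let N = sqrt (vf_gnorm2 r \<beta>0 u0 + sf_gnorm2 r \<beta>0 \<eta>0);
          R = ball 0 (radius CARD('d) C r \<beta>0 g N)
      in (\<exists>U E. bouss_sol r g e R u0 \<eta>0 U E) \<and>
         (\<forall>U E U' E'. bouss_sol r g e R u0 \<eta>0 U E \<longrightarrow> bouss_sol r g e R u0 \<eta>0 U' E' \<longrightarrow>
             (\<forall>\<zeta>\<in>R. U \<zeta> = U' \<zeta> \<and> E \<zeta> = E' \<zeta>)))"
proof -
  define D where "D = 1 + real CARD('d)"
  define A where "A = sqrt (infsum lattice_weight (UNIV :: (int^'d) set)) * sqrt (2 * (real CARD('d) + (8 * D)\<^sup>2))"
  define K where "K = pi * 2 ^ (CARD('d) - 1)"
  \<comment> \<open>Chosen so that D (A N) R \<le> \<beta> / 24: \<open>K\<close> cancels the lower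
    bound 1 / K for 2^r C_W(r), 24 is the constant of the series argument, and the added 1 keeps the
    denominator positive. The \<open>8 * D\<close> inside \<open>A\<close> is the weight
    \<mu>.\<close>
  define C where "C = 1 / (24 * (D * A + 1) * K)"
  have d: "1 \<le> real CARD('d)" using assms by auto
  then have D: "D \<ge> 2" by (simp add: D_def)
  have A: "A \<ge> 0" by (auto simp: A_def intro!: mult_nonneg_nonneg infsum_nonneg)
  have K: "K > 0" by (simp add: K_def)
  have DA: "D * A + 1 > 0" using mult_nonneg_nonneg[of D A] A D by linarith
  have C: "C > 0" using DA K by (simp add: C_def)
  have main: "(\<exists>U E. bouss_sol r g e (ball 0 R) u0 \<eta>0 U E) \<and>
      (\<forall>U E U' E'. bouss_sol r g e (ball 0 R) u0 \<eta>0 U E \<longrightarrow> bouss_sol r g e (ball 0 R) u0 \<eta>0 U' E' \<longrightarrow>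
             (\<forall>\<zeta>\<in>ball 0 R. U \<zeta> = U' \<zeta> \<and> E \<zeta> = E' \<zeta>))"
    if r: "r > (real CARD('d) + 1) / 2" and pos: "\<beta> > 0" "g > 0" and u0: "in_Hc u0" "vf_gev r \<beta> u0"
      and \<eta>0: "\<eta>0 0 = 0" "sf_gev r \<beta> \<eta>0" and N: "N = sqrt (vf_gnorm2 r \<beta> u0 + sf_gnorm2 r \<beta> \<eta>0)"
      and R: "R = radius CARD('d) C r \<beta> g N"
    for r \<beta> g N R :: real and e :: 'd and u0 :: "'d vf" and \<eta>0 :: "'d sf"
  proof -
    have "1 \<le> (real CARD('d) + 1) / 2" using d by simp
    also note r
    finally have r1: "1 \<le> r" by simp
    have vf0: "0 \<le> vf_gnorm2 r \<beta> u0"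
      by (auto simp: vf_gnorm2_def sum_nonneg intro!: mult_nonneg_nonneg infsum_nonneg)
    have N0: "0 \<le> N" using vf0 sf_gnorm2_nonneg[of r \<beta> \<eta>0] by (simp add: N)
    have CW: "1 / K \<le> 2 powr r * C_W CARD('d) r"
    proof -
      have "1 * (1 / K) \<le> 2 powr r * C_W CARD('d) r"
        using C_W_lower_bound[OF r] r1 K by (intro mult_mono ge_one_powr_ge_zero) (auto simp: K_def)
      then show ?thesis by simp
    qed
    have CW0: "0 < 2 powr r * C_W CARD('d) r"
      using CW K by (meson less_le_trans zero_less_divide_1_iff)
    have R0: "R > 0"
      using N0 pos C CW0 by (auto simp: R radius_def zero_less_mult_iff)
    have "R \<le> 2 * ln 2 / g" by (simp add: R radius_def)
    \<comment> \<open>The second term of the minimum gives g R \<le> 2 ln 2, and ln 2 < 1.\<close>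
    then have gR: "g * R \<le> 2"
      using pos ln_2_less_1 by (simp add: field_simps)
    \<comment> \<open>The product form also covers N = 0, where the radius is 2 ln 2 / g and the
      first term of the minimum is absent.\<close>
    have NR: "N * R \<le> C * \<beta> * K"
    proof (cases "N = 0")
      case True
      then show ?thesis using C pos K by simp
    next
      case False
      then have N1: "N > 0" using N0 by simp
      have "R \<le> C * \<beta> / (2 powr r * C_W CARD('d) r * N)" using False by (simp add: R radius_def)
      also have "\<dots> \<le> C * \<beta> / (1 / K * N)"
        using C pos CW K N1 by (intro divide_left_mono mult_right_mono mult_pos_pos CW0) auto
      finally show ?thesis using N1 K by (simp add: field_simps)
    qed
    have "D * (A * N) * R = D * A * (N * R)" by simp
    also have "\<dots> \<le> D * A * (C * \<beta> * K)"
      using D A by (intro mult_left_mono NR) auto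
    also have "\<dots> \<le> (D * A + 1) * (C * \<beta> * K)"
      using C pos K by (intro mult_right_mono) auto
    also have "\<dots> = \<beta> / 24"
    proof -
      have "x * (1 / (24 * x * K) * \<beta> * K) = \<beta> / 24" if "x > 0" for x
        using that K by (simp add: field_simps)
      from this[OF DA] show ?thesis by (simp add: C_def)
    qed
    finally have DPR: "D * (A * N) * R \<le> \<beta> / 24" .
    interpret boussinesq_series g R \<beta> "A * N" "8 * D" e u0 \<eta>0
    proof unfold_locales
      have \<mu>: "0 \<le> 8 * D" using D by simp
      show "(\<lambda>k. exp (\<beta> * kabs k) * (vabs u0 k + 8 * D * cmod (\<eta>0 k))) summable_on UNIV"
        by (rule gevrey_data_l1_bound[OF r u0 \<eta>0 \<mu>])
      show "(\<Sum>\<^sub>\<infinity>k. exp (\<beta> * kabs k) * (vabs u0 k + 8 * D * cmod (\<eta>0 k))) \<le> A * N"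
        unfolding A_def N by (rule gevrey_data_l1_bound[OF r u0 \<eta>0 \<mu>])
    qed (use pos R0 A N0 u0 \<eta>0 DPR gR in \<open>auto simp: D_def\<close>)
    have "\<exists>U E. bouss_sol r g e (ball 0 R) u0 \<eta>0 U E"
      by (intro exI, rule bouss_sol_series) (use r1 in simp)
    moreover have "U \<zeta> = U' \<zeta> \<and> E \<zeta> = E' \<zeta>"
      if "bouss_sol r g e (ball 0 R) u0 \<eta>0 U E" "bouss_sol r g e (ball 0 R) u0 \<eta>0 U' E'" "\<zeta> \<in> ball 0 R"
      for U E U' E' \<zeta>
      using that by (rule bouss_sol_unique[OF r1])
    ultimately show ?thesis by blast
  qed
  show ?thesis
    unfolding Let_def by (intro exI[of _ C] conjI[OF C] allI impI main) (elim conjE, assumption | rule refl)+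
qed

end
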